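(* Let $M$ be a discrete surface (the vertex set of a black and white triangulated smooth surface) and let $M'$ be the cellular decomposition whose vertices are the black triangles of $M$. Let $f\colon M\to S^4=\mathbb{H}\mathbb{P}^1$ be an immersion and let $f^\sharp\colon M'\to S^4=\mathbb{H}\mathbb{P}^1$ be a map such that the corresponding line subbundles $L$ and $L^\sharp$ of the trivial $\mathbb{H}^2$-bundles over $M$ and $M'$ satisfy $$L^\sharp_b\neq L_{v}\quad\text{for every black triangle } b \text{ and every vertex } v \text{ of } b .$$ Then the following conditions are equivalent: (i) around each white triangle $w$ of $M$, with vertices denoted $1,2,3$ and with the adjacent black triangles denoted $12,23,13$ (where $ij$ is the black triangle sharing with $w$ the edge joining $i$ and $j$ that borders $w$), the multi ratio condition $$M_6(x_1,x_{12},x_2,x_{23},x_3,x_{13})=-1$$ holds, where $x_i\in\mathbb{H}$ and $x_{ij}\in\mathbb{H}$ are the affine coordinates of $L_i$ and $L^\sharp_{ij}$; (ii) the connection on $L^\sharp$ given, along each edge of $M'$ joining $b_1$ to $b_2$ and belonging to the vertex $v\in b_1\cap b_2$, by $$P_{b_2b_1}\colon L^\sharp_{b_1}\xrightarrow{\ \pi\ }(V/L)_v\xrightarrow{\ \pi^{-1}\ }L^\sharp_{b_2}$$ is flat; (iii) locally the bundle $L^\sharp$ can be obtained by prolonging a (necessarily nowhere vanishing) holomorphic section of $V/L$.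
   Context: Discrete surfaces. A discrete surface $M$ is the vertex set $\mathcal V$ of a triangulation $(\mathcal V,\mathcal E,\mathcal F)$ of an oriented smooth surface (without boundary) whose set of faces is decomposed as $\mathcal F=\mathcal B\,\dot\cup\,\mathcal W$ into black and white triangles such that two triangles of the same color never share an edge. Triangulation means a cellular decomposition with triangular faces that is regular, i.e. the glueing map on the boundary of each 1- and 2-cell is injective (so the three vertices and edges of a triangle are distinct); it need not be simplicial. Coverings of $M$ are the vertex sets of the triangulations induced on coverings of the underlying surface. The cellular decomposition $M'$ (of the same surface) has vertex set $\mathcal B$; its faces are the elements of $\mathcal W$ and of $\mathcal V$. Its edges correspond to pairs $(w,v)$ with $w\in\mathcal W$ and $v$ a vertex of $w$: the edge $(w,v)$ joins the two black triangles $b_1,b_2$ adjacent to $w$ along the two edges of $w$ incident to $v$ (so $b_1,b_2$ both contain $v$); "the edge belongs to $v$". The face $w\in\mathcal W$ is bounded by the three edges $(w,v)$; the face $v\in\mathcal V$ is bounded by the edges $(w,v)$ with $w\ni v$. Quaternionic vector spaces are right $\mathbb{H}$-vector spaces. A map $f\colon M\to S^4=\mathbb{H}\mathbb{P}^1$ is identified with the line subbundle $L$, $L_p=f(p)\subset\mathbb{H}^2$, of the trivial $\mathbb{H}^2$-bundle $V$ over $M$; similarly for $f^\sharp$ and $M'$. $f$ is an immersion if $f(p)\ne f(q)$ for adjacent vertices $p,q$. The quotient line bundle $V/L$ (fibers $(V/L)_p=\mathbb{H}^2/L_p$) has the following holomorphic structure: a section $\psi$ of $V/L$ is holomorphic if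 for each black triangle $b$ there is $\hat\psi_b\in\mathbb{H}^2$ with $\psi_v=\pi\hat\psi_b$ for every vertex $v$ of $b$, where $\pi$ denotes the canonical projection to $V/L$. The vector $\hat\psi_b$ is then unique, and the section $\hat\psi$ of the trivial $\mathbb{H}^2$-bundle over $\mathcal B$ is called the prolongation of $\psi$. "$L^\sharp$ is obtained by prolonging $\psi$" means $L^\sharp_b=\hat\psi_b\mathbb{H}$ for all $b$. "Locally" means: after pulling back to the universal covering of (each component of) $M$. A connection on $L^\sharp$ is a system of $\mathbb{H}$-linear isomorphisms along the edges of $M'$; it is flat if its holonomy around every face of $M'$ (both types) is trivial. Multi ratio: $M_6(x_1,\dots,x_6)=(x_1-x_2)(x_2-x_3)^{-1}(x_3-x_4)(x_4-x_5)^{-1}(x_5-x_6)(x_6-x_1)^{-1}$ for $x_1,\dots,x_6\in\mathbb{H}$. The affine coordinate $x\in\mathbb{H}$ corresponds to the line $\binom{x}{1}\mathbb{H}\in\mathbb{H}\mathbb{P}^1$; the affine chart is assumed chosen (after a quaternionic projective transformation) so that the points involved are finite. *)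

theory Defs
  imports Complex_Main "HOL-Library.Set_Algebras" "HOL-Library.Product_Plus"
begin

section \<open>Quaternions\<close>

datatype quat = Quat (qre: real) (qi: real) (qj: real) (qk: real)

instantiation quat :: division_ring
begin

definition "0 = Quat 0 0 0 0"

definition "1 = Quat 1 0 0 0"

definition "x + y = Quat (qre x + qre y) (qi x + qi y) (qj x + qj y) (qk x + qk y)"

definition "x - y = Quat (qre x - qre y) (qi x - qi y) (qj x - qj y) (qk x - qk y)"

definition "- x = Quat (- qre x) (- qi x) (- qj x) (- qk x)"

definition "x * y = Quat
  (qre x * qre y - qi x * qi y - qj x * qj y - qk x * qk y)
  (qre x * qi y + qi x * qre y + qj x * qk y - qk x * qj y)
  (qre x * qj y - qi x * qk y + qj x * qre y + qk x * qi y)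
  (qre x * qk y + qi x * qj y - qj x * qi y + qk x * qre y)"

definition "inverse x =
  (let n = (qre x)\<^sup>2 + (qi x)\<^sup>2 + (qj x)\<^sup>2 + (qk x)\<^sup>2
   in Quat (qre x / n) (- qi x / n) (- qj x / n) (- qk x / n))"

definition "x div y = x * inverse y" for x y :: quat

lemmas quat_defs = zero_quat_def one_quat_def plus_quat_def minus_quat_def uminus_quat_def
  times_quat_def inverse_quat_def divide_quat_def

lemma quat_norm_pos:
  assumes "x \<noteq> 0"
  shows "(qre x)\<^sup>2 + (qi x)\<^sup>2 + (qj x)\<^sup>2 + (qk x)\<^sup>2 > 0"
proof -
  have "qre x \<noteq> 0 \<or> qi x \<noteq> 0 \<or> qj x \<noteq> 0 \<or> qk x \<noteq> 0"
    using assms by (cases x) (auto simp: zero_quat_def)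
  then show ?thesis
    by (smt (verit) zero_less_power2 zero_le_power2)
qed

instance
proof
  fix x y z :: quat
  show "x * y * z = x * (y * z)"
    by (simp add: times_quat_def algebra_simps)
  show "x \<noteq> 0 \<Longrightarrow> inverse x * x = 1"
  proof -
    assume "x \<noteq> 0"
    define n where "n = (qre x)\<^sup>2 + (qi x)\<^sup>2 + (qj x)\<^sup>2 + (qk x)\<^sup>2"
    with quat_norm_pos[OF \<open>x \<noteq> 0\<close>] have n: "n \<noteq> 0"
      "qre x * qre x + qi x * qi x + qj x * qj x + qk x * qk x = n"
      by (simp_all add: power2_eq_square)
    have "inverse x = Quat (qre x / n) (- qi x / n) (- qj x / n) (- qk x / n)"
      by (simp add: inverse_quat_def n_def Let_def)
    then show ?thesis
      using n by (simp add: times_quat_def one_quat_def field_simps)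
  qed
  show "x \<noteq> 0 \<Longrightarrow> x * inverse x = 1"
  proof -
    assume "x \<noteq> 0"
    define n where "n = (qre x)\<^sup>2 + (qi x)\<^sup>2 + (qj x)\<^sup>2 + (qk x)\<^sup>2"
    with quat_norm_pos[OF \<open>x \<noteq> 0\<close>] have n: "n \<noteq> 0"
      "qre x * qre x + qi x * qi x + qj x * qj x + qk x * qk x = n"
      by (simp_all add: power2_eq_square)
    have "inverse x = Quat (qre x / n) (- qi x / n) (- qj x / n) (- qk x / n)"
      by (simp add: inverse_quat_def n_def Let_def)
    then show ?thesis
      using n by (simp add: times_quat_def one_quat_def field_simps)
  qed
qed (simp_all add: quat_defs algebra_simps Let_def)

end

section \<open>The right vector space \<open>\<bbbH>\<^sup>2\<close> and its projective line\<close>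

type_synonym quat2 = "quat \<times> quat"

definition rscale :: "quat2 \<Rightarrow> quat \<Rightarrow> quat2"  (infixl \<open>\<cdot>\<close> 75)
  where "x \<cdot> q = (fst x * q, snd x * q)"

definition qspan :: "quat2 \<Rightarrow> quat2 set"
  where "qspan x = range (\<lambda>q. x \<cdot> q)"

definition HP1 :: "quat2 set set"
  where "HP1 = {qspan x | x. x \<noteq> 0}"

definition finite_point :: "quat2 set \<Rightarrow> bool"
  where "finite_point l \<longleftrightarrow> (\<exists>x. l = qspan (x, 1))"

definition affine_coord :: "quat2 set \<Rightarrow> quat"
  where "affine_coord l = (THE x. l = qspan (x, 1))"

text \<open>Right \<open>\<bbbH>\<close>-linear isomorphisms between subspaces \<open>X\<close> and \<open>Y\<close> of \<open>\<bbbH>\<^sup>2\<close>. With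
  \<open>X = Y = UNIV\<close> these are the elements of \<open>GL(2, \<bbbH>)\<close>, which induce the quaternionic
  projective transformations \<open>l \<mapsto> A ` l\<close> of \<open>\<bbbH>P\<^sup>1\<close>.\<close>

definition qlinear_iso :: "quat2 set \<Rightarrow> quat2 set \<Rightarrow> (quat2 \<Rightarrow> quat2) \<Rightarrow> bool"
  where "qlinear_iso X Y T \<longleftrightarrow> bij_betw T X Y \<and>
    (\<forall>x\<in>X. \<forall>y\<in>X. T (x + y) = T x + T y) \<and>
    (\<forall>x\<in>X. \<forall>q. T (x \<cdot> q) = T x \<cdot> q)"

definition multi_ratio :: "quat \<Rightarrow> quat \<Rightarrow> quat \<Rightarrow> quat \<Rightarrow> quat \<Rightarrow> quat \<Rightarrow> quat"
  where "multi_ratio x1 x2 x3 x4 x5 x6 =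
    (x1 - x2) * inverse (x2 - x3) * (x3 - x4) * inverse (x4 - x5) * (x5 - x6) * inverse (x6 - x1)"

section \<open>Discrete surfaces\<close>

text \<open>A triangulation of an oriented surface is given by its vertices, its black and white
  faces, and its oriented edges (darts). The dart \<open>d\<close> starts at the vertex \<open>org d\<close> and has the
  face \<open>face d\<close> on its left; \<open>opp d\<close> is the same edge with the reversed orientation, and
  \<open>nxt d\<close> is the dart that follows \<open>d\<close> on the oriented boundary of \<open>face d\<close>. The (unoriented)
  edges are the pairs \<open>{d, opp d}\<close>.\<close>

record ('v, 'f, 'd) triangulation =
  verts :: "'v set"
  blacks :: "'f set"
  whites :: "'f set"
  darts :: "'d set"
  org :: "'d \<Rightarrow> 'v"
  face :: "'d \<Rightarrow> 'f"
  opp :: "'d \<Rightarrow> 'd"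
  nxt :: "'d \<Rightarrow> 'd"

text \<open>The rotation about \<open>org d\<close> to the next dart starting at the same vertex.\<close>

definition rot :: "('v, 'f, 'd) triangulation \<Rightarrow> 'd \<Rightarrow> 'd"
  where "rot M d = nxt M (opp M d)"

text \<open>By \<open>org_iff\<close>, the darts at a vertex form a single finite cycle under the rotation (they
  form one orbit, in which every \<open>d\<close> is reached again from \<open>rot M d\<close>), so the triangles around
  it form a disc: the triangulated space is a surface without boundary. By \<open>color_opp\<close>, the two
  triangles at an edge have different colors. \<open>regular\<close> says that the end points of an edge are
  distinct; hence so are the vertices of a triangle, and its edges are distinct by \<open>color_opp\<close>.
  Different edges may have the same end points and different triangles the same vertices.\<close>

locale discrete_surface =
  fixes M :: "('v, 'f, 'd) triangulation"
  assumes opp_in: "d \<in> darts M \<Longrightarrow> opp M d \<in> darts M"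
    and nxt_in: "d \<in> darts M \<Longrightarrow> nxt M d \<in> darts M"
    and opp_opp: "d \<in> darts M \<Longrightarrow> opp M (opp M d) = d"
    and nxt_nxt_nxt: "d \<in> darts M \<Longrightarrow> nxt M (nxt M (nxt M d)) = d"
    and faces: "face M ` darts M = blacks M \<union> whites M"
    and face_iff: "\<lbrakk>d \<in> darts M; d' \<in> darts M\<rbrakk> \<Longrightarrow>
      face M d = face M d' \<longleftrightarrow> d' \<in> {d, nxt M d, nxt M (nxt M d)}"
    and vertices: "org M ` darts M = verts M"
    and org_nxt: "d \<in> darts M \<Longrightarrow> org M (nxt M d) = org M (opp M d)"
    and org_iff: "\<lbrakk>d \<in> darts M; d' \<in> darts M\<rbrakk> \<Longrightarrow>
      org M d = org M d' \<longleftrightarrow> (\<exists>n. d' = (rot M ^^ n) d)"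
    and regular: "d \<in> darts M \<Longrightarrow> org M (opp M d) \<noteq> org M d"
    and colors_disjoint: "blacks M \<inter> whites M = {}"
    and color_opp: "d \<in> darts M \<Longrightarrow> face M d \<in> blacks M \<longleftrightarrow> face M (opp M d) \<in> whites M"

definition verts_of :: "('v, 'f, 'd) triangulation \<Rightarrow> 'f \<Rightarrow> 'v set"
  where "verts_of M t = org M ` {d \<in> darts M. face M d = t}"

definition white_darts :: "('v, 'f, 'd) triangulation \<Rightarrow> 'd set"
  where "white_darts M = {d \<in> darts M. face M d \<in> whites M}"

section \<open>The universal covering\<close>

fun is_path :: "('v, 'f, 'd) triangulation \<Rightarrow> 'v \<Rightarrow> 'd list \<Rightarrow> bool"
  where "is_path M v [] \<longleftrightarrow> v \<in> verts M"
  | "is_path M v (d # ds) \<longleftrightarrow> d \<in> darts M \<and> org M d = v \<and> is_path M (org M (opp M d)) ds"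

fun path_end :: "('v, 'f, 'd) triangulation \<Rightarrow> 'v \<Rightarrow> 'd list \<Rightarrow> 'v"
  where "path_end M v [] = v"
  | "path_end M v (d # ds) = path_end M (org M (opp M d)) ds"

text \<open>Edge paths are homotopic (with fixed end points) if they are related by insertions and
  deletions of spurs and of boundaries of triangles.\<close>

inductive elementary_homotopy ::
    "('v, 'f, 'd) triangulation \<Rightarrow> 'v \<Rightarrow> 'd list \<Rightarrow> 'd list \<Rightarrow> bool"
  for M v where
    spur: "is_path M v (xs @ [d, opp M d] @ ys) \<Longrightarrow>
      elementary_homotopy M v (xs @ [d, opp M d] @ ys) (xs @ ys)"
  | triangle: "is_path M v (xs @ [d, nxt M d, nxt M (nxt M d)] @ ys) \<Longrightarrow>
      elementary_homotopy M v (xs @ [d, nxt M d, nxt M (nxt M d)] @ ys) (xs @ ys)"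

definition homotopy_class :: "('v, 'f, 'd) triangulation \<Rightarrow> 'v \<Rightarrow> 'd list \<Rightarrow> 'd list set"
  where "homotopy_class M v ds = {ds'. equivclp (elementary_homotopy M v) ds ds'}"

definition append_class ::
    "('v, 'f, 'd) triangulation \<Rightarrow> 'v \<Rightarrow> 'd list set \<Rightarrow> 'd \<Rightarrow> 'd list set"
  where "append_class M v c d = (\<Union>ds\<in>c. homotopy_class M v (ds @ [d]))"

definition cover_nxt :: "('v, 'f, 'd) triangulation \<Rightarrow> 'v \<Rightarrow>
    'd list set \<times> 'd \<Rightarrow> 'd list set \<times> 'd"
  where "cover_nxt M v = (\<lambda>(c, d). (append_class M v c d, nxt M d))"

definition cover_face :: "('v, 'f, 'd) triangulation \<Rightarrow> 'v \<Rightarrow>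
    'd list set \<times> 'd \<Rightarrow> 'f \<times> ('d list set \<times> 'd) set"
  where "cover_face M v x =
    (face M (snd x), {x, cover_nxt M v x, cover_nxt M v (cover_nxt M v x)})"

definition cover_darts :: "('v, 'f, 'd) triangulation \<Rightarrow> 'v \<Rightarrow> ('d list set \<times> 'd) set"
  where "cover_darts M v =
    {(homotopy_class M v ds, d) | ds d. is_path M v ds \<and> d \<in> darts M \<and> org M d = path_end M v ds}"

text \<open>The triangulation of the universal covering of the component of \<open>v\<close>, constructed from the
  edge paths starting at \<open>v\<close>. The vertices over \<open>u\<close> are the pairs \<open>(u, c)\<close> with \<open>c\<close> a homotopy
  class of paths from \<open>v\<close> to \<open>u\<close>, the darts over \<open>d\<close> are the pairs \<open>(c, d)\<close> with \<open>c\<close> a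
  homotopy class of paths from \<open>v\<close> to \<open>org M d\<close>, and the faces over \<open>t\<close> are the pairs of \<open>t\<close> and
  an orbit of three darts. Thus the covering projection is \<open>fst\<close> on vertices and on faces,
  and \<open>snd\<close> on darts.\<close>

definition universal_cover :: "('v, 'f, 'd) triangulation \<Rightarrow> 'v \<Rightarrow>
    ('v \<times> 'd list set, 'f \<times> ('d list set \<times> 'd) set, 'd list set \<times> 'd) triangulation"
  where "universal_cover M v = \<lparr>
    verts = {(path_end M v ds, homotopy_class M v ds) | ds. is_path M v ds},
    blacks = cover_face M v ` {x \<in> cover_darts M v. face M (snd x) \<in> blacks M},
    whites = cover_face M v ` {x \<in> cover_darts M v. face M (snd x) \<in> whites M},
    darts = cover_darts M v,
    org = (\<lambda>(c, d). (org M d, c)),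
    face = cover_face M v,
    opp = (\<lambda>(c, d). (append_class M v c d, opp M d)),
    nxt = cover_nxt M v\<rparr>"

text \<open>The rest of the section shows that this is a discrete surface which is connected and in
  which every closed edge path is null homotopic. \<open>cover_lift v ds es\<close> lifts the path \<open>es\<close> to
  the covering, starting at the class of \<open>ds\<close>.\<close>

context discrete_surface
begin

lemma org_opp_nxt: "d \<in> darts M \<Longrightarrow> org M (opp M (opp M d)) = org M d"
  by (simp add: opp_opp)

lemma org_in: "d \<in> darts M \<Longrightarrow> org M d \<in> verts M"
  using vertices by auto

lemma is_path_append:
  "is_path M v (xs @ ys) \<longleftrightarrow> is_path M v xs \<and> is_path M (path_end M v xs) ys"
proof (induction xs arbitrary: v)
  case Nil
  then show ?case by (cases ys) (auto simp: org_in)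
qed auto

lemma path_end_append: "path_end M v (xs @ ys) = path_end M (path_end M v xs) ys"
  by (induction xs arbitrary: v) auto

lemma path_end_triangle:
  "d \<in> darts M \<Longrightarrow> org M (opp M (nxt M (nxt M d))) = org M d"
  using org_nxt[of "nxt M (nxt M d)"] by (simp add: nxt_in nxt_nxt_nxt)

lemma elementary_homotopy_path:
  assumes "elementary_homotopy M v ds ds'"
  shows "is_path M v ds \<and> is_path M v ds' \<and> path_end M v ds = path_end M v ds'"
  using assms
proof cases
  case (spur xs d ys)
  then show ?thesis by (auto simp: is_path_append path_end_append org_opp_nxt)
next
  case (triangle xs d ys)
  then show ?thesis by (auto simp: is_path_append path_end_append path_end_triangle)
qed

lemma homotopic_path:
  assumes "equivclp (elementary_homotopy M v) ds ds'"
  shows "(is_path M v ds \<longleftrightarrow> is_path M v ds') \<and> path_end M v ds = path_end M v ds'"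
  using assms
  by (induction rule: equivclp_induct) (auto dest: elementary_homotopy_path)

lemma homotopy_class_eq_iff:
  "homotopy_class M v ds = homotopy_class M v ds' \<longleftrightarrow> equivclp (elementary_homotopy M v) ds ds'"
  unfolding homotopy_class_def
  by (auto intro: equivclp_sym equivclp_trans)

lemma elementary_homotopy_append:
  assumes "elementary_homotopy M v ds ds'" "is_path M (path_end M v ds) es"
  shows "elementary_homotopy M v (ds @ es) (ds' @ es)"
  using assms
proof cases
  case (spur xs d ys)
  then show ?thesis using assms(2) elementary_homotopy.spur[of M v xs d "ys @ es"]
    by (simp add: is_path_append path_end_append)
next
  case (triangle xs d ys)
  then show ?thesis using assms(2) elementary_homotopy.triangle[of M v xs d "ys @ es"]
    by (simp add: is_path_append path_end_append)
qed

lemma homotopic_append: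
  assumes "equivclp (elementary_homotopy M v) ds ds'" "is_path M (path_end M v ds) es"
  shows "equivclp (elementary_homotopy M v) (ds @ es) (ds' @ es)"
  using assms
proof (induction rule: equivclp_induct)
  case (step y z)
  have "is_path M (path_end M v y) es" "is_path M (path_end M v z) es"
    using homotopic_path[OF step(1)] step(2) step(4) elementary_homotopy_path by metis+
  then have "equivclp (elementary_homotopy M v) (y @ es) (z @ es)"
    using step(2) elementary_homotopy_append by (auto simp: r_into_equivclp converse_r_into_equivclp)
  then show ?case using step by (meson equivclp_trans)
qed auto

lemma append_class:
  assumes "d \<in> darts M" "org M d = path_end M v ds"
  shows "append_class M v (homotopy_class M v ds) d = homotopy_class M v (ds @ [d])"
proof -
  have "homotopy_class M v (ds' @ [d]) = homotopy_class M v (ds @ [d])"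
    if "ds' \<in> homotopy_class M v ds" for ds'
  proof -
    have "equivclp (elementary_homotopy M v) (ds @ [d]) (ds' @ [d])"
      using homotopic_append[of v ds ds' "[d]"] that assms
      by (simp add: homotopy_class_def org_in opp_in)
    then show ?thesis by (simp add: homotopy_class_eq_iff equivclp_sym)
  qed
  moreover have "ds \<in> homotopy_class M v ds" by (simp add: homotopy_class_def)
  ultimately show ?thesis unfolding append_class_def by blast
qed

lemma class_spur:
  assumes "is_path M v ds" "d \<in> darts M" "org M d = path_end M v ds"
  shows "homotopy_class M v (ds @ [d, opp M d]) = homotopy_class M v ds"
  using elementary_homotopy.spur[of M v ds d "[]"] assms org_in[OF assms(2)]
  by (simp add: homotopy_class_eq_iff r_into_equivclp is_path_append org_in opp_in opp_opp)

lemma class_triangle: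
  assumes "is_path M v ds" "d \<in> darts M" "org M d = path_end M v ds"
  shows "homotopy_class M v (ds @ [d, nxt M d, nxt M (nxt M d)]) = homotopy_class M v ds"
  using elementary_homotopy.triangle[of M v ds d "[]"] assms org_in[OF assms(2)]
  by (simp add: homotopy_class_eq_iff r_into_equivclp is_path_append org_in opp_in opp_opp
      nxt_in org_nxt path_end_triangle)

lemma cover_dartE:
  assumes "x \<in> cover_darts M v"
  obtains ds d where "x = (homotopy_class M v ds, d)" "is_path M v ds" "d \<in> darts M"
    "org M d = path_end M v ds"
  using assms by (auto simp: cover_darts_def)

lemma cover_dartI:
  assumes "is_path M v ds" "d \<in> darts M" "org M d = path_end M v ds"
  shows "(homotopy_class M v ds, d) \<in> cover_darts M v"
  using assms by (auto simp: cover_darts_def)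

lemma cover_nxt_in: 
  assumes "is_path M v ds" "d \<in> darts M" "org M d = path_end M v ds"
  shows "(homotopy_class M v (ds @ [d]), nxt M d) \<in> cover_darts M v"
  using assms by (intro cover_dartI) (auto simp: is_path_append path_end_append org_in opp_in nxt_in org_nxt)

lemma cover_opp_in: 
  assumes "is_path M v ds" "d \<in> darts M" "org M d = path_end M v ds"
  shows "(homotopy_class M v (ds @ [d]), opp M d) \<in> cover_darts M v"
  using assms by (intro cover_dartI) (auto simp: is_path_append path_end_append org_in opp_in nxt_in org_nxt)

lemma cover_nxt_class:
  assumes "d \<in> darts M" "org M d = path_end M v ds"
  shows "cover_nxt M v (homotopy_class M v ds, d) = (homotopy_class M v (ds @ [d]), nxt M d)"
  using assms by (simp add: cover_nxt_def append_class)

lemma nxt2_opp: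
  assumes "d \<in> darts M"
  shows "org M (nxt M (opp M d)) = org M d"
  using assms by (simp add: org_nxt opp_in opp_opp)

lemma cover_nxt3:
  assumes "is_path M v ds" "d \<in> darts M" "org M d = path_end M v ds"
  shows "cover_nxt M v (cover_nxt M v (homotopy_class M v ds, d)) =
     (homotopy_class M v (ds @ [d, nxt M d]), nxt M (nxt M d))"
   "cover_nxt M v (cover_nxt M v (cover_nxt M v (homotopy_class M v ds, d))) = (homotopy_class M v ds, d)"
  using assms class_triangle[OF assms]
  by (simp_all add: cover_nxt_class is_path_append path_end_append org_in opp_in nxt_in org_nxt nxt_nxt_nxt)

lemma rot_cover:
  assumes "is_path M v ds" "d \<in> darts M" "org M d = path_end M v ds"
  shows "rot (universal_cover M v) (homotopy_class M v ds, d) = (homotopy_class M v ds, rot M d)"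
  using assms class_spur[OF assms]
  by (simp add: rot_def universal_cover_def append_class cover_nxt_class path_end_append opp_in)

lemma rot_pow:
  assumes "d \<in> darts M"
  shows "(rot M ^^ n) d \<in> darts M \<and> org M ((rot M ^^ n) d) = org M d"
  by (induction n) (auto simp: assms rot_def nxt_in opp_in nxt2_opp)

lemma rot_pow_cover:
  assumes "is_path M v ds" "d \<in> darts M" "org M d = path_end M v ds"
  shows "(rot (universal_cover M v) ^^ n) (homotopy_class M v ds, d) = (homotopy_class M v ds, (rot M ^^ n) d)"
  by (induction n) (use assms rot_cover rot_pow in auto)

lemma universal_cover_discrete_surface:
  assumes "v \<in> verts M"
  shows "discrete_surface (universal_cover M v)" (is "discrete_surface ?U")
proof
  note [simp] = is_path_append path_end_append org_in opp_in nxt_in org_nxt nxt_nxt_nxt opp_opp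
    append_class cover_nxt_class
  have [simp]: "darts ?U = cover_darts M v" "face ?U = cover_face M v"
    "nxt ?U = cover_nxt M v" by (simp_all add: universal_cover_def)
  have opp: "opp ?U (homotopy_class M v ds, d) = (homotopy_class M v (ds @ [d]), opp M d)"
    if "d \<in> darts M" "org M d = path_end M v ds" for d ds
    using that by (simp add: universal_cover_def)
  have org: "org ?U (c, d) = (org M d, c)" for c d by (simp add: universal_cover_def)
  fix x assume x: "x \<in> darts ?U"
  then obtain ds d where d: "x = (homotopy_class M v ds, d)" "is_path M v ds" "d \<in> darts M"
    "org M d = path_end M v ds" by (auto elim: cover_dartE)
  show "opp ?U x \<in> darts ?U" using d cover_opp_in opp by simp
  show "nxt ?U x \<in> darts ?U" using d cover_nxt_in by simp
  show "opp ?U (opp ?U x) = x" using d class_spur[OF d(2-)] by (simp add: opp)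
  show "nxt ?U (nxt ?U (nxt ?U x)) = x" using d cover_nxt3 by simp
  show "org ?U (nxt ?U x) = org ?U (opp ?U x)" using d by (simp add: opp org)
  show "org ?U (opp ?U x) \<noteq> org ?U x" using d regular[OF d(3)] by (simp add: opp org)
  have f: "face M d \<in> blacks M \<union> whites M" using faces d by blast
  have bl: "cover_face M v y \<in> blacks ?U \<longleftrightarrow> face M (snd y) \<in> blacks M"
     "cover_face M v y \<in> whites ?U \<longleftrightarrow> face M (snd y) \<in> whites M"
    if "y \<in> cover_darts M v" for y using that
    by (auto simp: universal_cover_def cover_face_def)
  show "face ?U x \<in> blacks ?U \<longleftrightarrow> face ?U (opp ?U x) \<in> whites ?U"
    using d color_opp[OF d(3)] bl cover_opp_in[OF d(2-)] x opp by simp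
  fix x' assume x': "x' \<in> darts ?U"
  then obtain ds' d' where d': "x' = (homotopy_class M v ds', d')" "is_path M v ds'" "d' \<in> darts M"
    "org M d' = path_end M v ds'" by (auto elim: cover_dartE)
  show "face ?U x = face ?U x' \<longleftrightarrow> x' \<in> {x, nxt ?U x, nxt ?U (nxt ?U x)}"
  proof
    assume "face ?U x = face ?U x'"
    then have "x' \<in> {x, cover_nxt M v x, cover_nxt M v (cover_nxt M v x)}"
      by (auto simp: cover_face_def)
    then show "x' \<in> {x, nxt ?U x, nxt ?U (nxt ?U x)}" by simp
  next
    assume "x' \<in> {x, nxt ?U x, nxt ?U (nxt ?U x)}"
    moreover have "face M (nxt M d) = face M d" "face M (nxt M (nxt M d)) = face M d"
      using face_iff[of d "nxt M d"] face_iff[of d "nxt M (nxt M d)"] d by auto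
    moreover have snd: "snd (cover_nxt M v y) = nxt M (snd y)" for y
      by (simp add: cover_nxt_def split: prod.split)
    moreover have "cover_nxt M v (cover_nxt M v (cover_nxt M v x)) = x"
      unfolding d(1) by (rule cover_nxt3(2)[OF d(2-)])
    moreover have "snd x = d" using d by simp
    ultimately have "cover_face M v x' = cover_face M v x"
      unfolding cover_face_def by (elim insertE emptyE) (simp_all add: insert_commute)
    then show "face ?U x = face ?U x'" by simp
  qed
  show "org ?U x = org ?U x' \<longleftrightarrow> (\<exists>n. x' = (rot ?U ^^ n) x)"
  proof -
    have "org ?U x = org ?U x' \<longleftrightarrow> org M d = org M d' \<and> homotopy_class M v ds = homotopy_class M v ds'"
      using d d' org by auto
    also have "\<dots> \<longleftrightarrow> (\<exists>n. x' = (rot ?U ^^ n) x)"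
      using d(1) d'(1) org_iff[OF d(3) d'(3)] rot_pow_cover[OF d(2-)] by auto
    finally show ?thesis .
  qed
next
  have "face M (snd x) \<in> blacks M \<union> whites M" if "x \<in> cover_darts M v" for x
    using that faces by (auto simp: cover_darts_def)
  then show "face ?U ` darts ?U = blacks ?U \<union> whites ?U"
    unfolding universal_cover_def by (simp del: Un_iff) blast
  show "blacks ?U \<inter> whites ?U = {}"
    using colors_disjoint by (auto simp: universal_cover_def cover_face_def)
  show "org ?U ` darts ?U = verts ?U"
  proof -
    have "\<exists>d\<in>darts M. org M d = path_end M v ds" if "is_path M v ds" for ds
      using that assms
    proof (cases ds rule: rev_cases)
      case (snoc ys y)
      then have "nxt M y \<in> darts M" "org M (nxt M y) = path_end M v ds" using that
        by (auto simp: is_path_append path_end_append nxt_in org_nxt)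
      then show ?thesis by blast
    next
      case Nil
      have "v \<in> org M ` darts M" using assms by (simp only: vertices)
      then show ?thesis using Nil by auto
    qed
    then have "(path_end M v ds, homotopy_class M v ds) \<in> org ?U ` darts ?U"
      if ds: "is_path M v ds" for ds
    proof -
      from \<open>\<And>ds. is_path M v ds \<Longrightarrow> \<exists>d\<in>darts M. org M d = path_end M v ds\<close>[OF ds]
      obtain d where d: "d \<in> darts M" "org M d = path_end M v ds" by blast
      have "org ?U (homotopy_class M v ds, d) = (path_end M v ds, homotopy_class M v ds)"
        using d by (simp add: universal_cover_def)
      moreover have "(homotopy_class M v ds, d) \<in> darts ?U"
        using cover_dartI[OF ds d] by (simp add: universal_cover_def)
      ultimately show ?thesis by (metis imageI)
    qed
    then have "verts ?U \<subseteq> org ?U ` darts ?U"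
      by (auto simp: universal_cover_def)
    moreover have "org ?U ` darts ?U \<subseteq> verts ?U"
      by (auto simp: universal_cover_def cover_darts_def)
    ultimately show ?thesis by blast
  qed
qed

fun cover_lift :: "'v \<Rightarrow> 'd list \<Rightarrow> 'd list \<Rightarrow> ('d list set \<times> 'd) list"
  where "cover_lift v ds [] = []"
  | "cover_lift v ds (e # es) = (homotopy_class M v ds, e) # cover_lift v (ds @ [e]) es"

lemma lift_append: "cover_lift v ds (es @ es') = cover_lift v ds es @ cover_lift v (ds @ es) es'"
  by (induction es arbitrary: ds) auto

lemma universal_cover_opp:
  assumes "d \<in> darts M" "org M d = path_end M v ds"
  shows "opp (universal_cover M v) (homotopy_class M v ds, d) = (homotopy_class M v (ds @ [d]), opp M d)"
  using assms by (simp add: universal_cover_def append_class)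

lemma lift_path:
  assumes "is_path M v ds" "is_path M (path_end M v ds) es"
  shows "is_path (universal_cover M v) (path_end M v ds, homotopy_class M v ds) (cover_lift v ds es)"
  using assms
proof (induction es arbitrary: ds)
  case Nil
  then show ?case by (auto simp: universal_cover_def)
next
  case (Cons e es)
  then have "is_path M v (ds @ [e])" by (simp add: is_path_append org_in opp_in)
  from Cons.IH[OF this] Cons.prems cover_dartI[of v ds e] universal_cover_opp[of e v ds]
  show ?case by (simp add: path_end_append) (simp add: universal_cover_def)
qed

lemma path_is_lift:
  assumes "is_path M v ds" "is_path (universal_cover M v) (path_end M v ds, homotopy_class M v ds) X"
  shows "cover_lift v ds (map snd X) = X \<and> is_path M (path_end M v ds) (map snd X) \<and>
    path_end (universal_cover M v) (path_end M v ds, homotopy_class M v ds) X =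
      (path_end M v (ds @ map snd X), homotopy_class M v (ds @ map snd X))"
  using assms
proof (induction X arbitrary: ds)
  case Nil
  then show ?case by (auto simp: is_path_append org_in)
     (metis is_path.simps(1) is_path_append append_Nil2)
next
  case (Cons x X)
  obtain c e where x: "x = (c, e)" by (cases x)
  from Cons.prems(2) have "x \<in> cover_darts M v" 
    and o: "org M e = path_end M v ds" "c = homotopy_class M v ds"
    by (auto simp: universal_cover_def x)
  then have e: "e \<in> darts M" using x by (auto simp: cover_darts_def)
  have p: "is_path M v (ds @ [e])" using Cons.prems e o by (simp add: is_path_append org_in opp_in)
  have q: "org (universal_cover M v) (opp (universal_cover M v) x) = (path_end M v (ds @ [e]), homotopy_class M v (ds @ [e]))"
    using universal_cover_opp[OF e o(1)] x o(2) by (simp add: universal_cover_def path_end_append)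
  show ?case using Cons.IH[OF p] Cons.prems(2) q e o x by (simp add: path_end_append)
qed

lemma path_start: "is_path M v ds \<Longrightarrow> v \<in> verts M"
  by (cases ds) (auto simp: org_in)

lemma lift_cong:
  assumes "homotopy_class M v as = homotopy_class M v bs" "is_path M (path_end M v as) ys"
  shows "cover_lift v as ys = cover_lift v bs ys"
  using assms
proof (induction ys arbitrary: as bs)
  case (Cons y ys)
  then have "homotopy_class M v (as @ [y]) = homotopy_class M v (bs @ [y])"
    using homotopic_append[of v as bs "[y]"]
    by (simp add: homotopy_class_eq_iff org_in opp_in)
  moreover have "is_path M (path_end M v (as @ [y])) ys"
    using Cons.prems by (simp add: path_end_append)
  ultimately have "cover_lift v (as @ [y]) ys = cover_lift v (bs @ [y]) ys" by (rule Cons.IH)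
  then show ?case using Cons.prems(1) by simp
qed simp

lemma elementary_homotopy_lift:
  assumes "elementary_homotopy M v es es'"
  shows "elementary_homotopy (universal_cover M v) (v, homotopy_class M v [])
    (cover_lift v [] es) (cover_lift v [] es')"
  using assms
proof cases
  case (spur xs d ys)
  then have *: "is_path M v xs" "d \<in> darts M" "org M d = path_end M v xs" "v \<in> verts M"
    by (auto simp: is_path_append intro: path_start)
  have l: "cover_lift v (xs @ [d, opp M d]) ys = cover_lift v xs ys"
  proof (rule lift_cong)
    show "is_path M (path_end M v (xs @ [d, opp M d])) ys"
      using spur by (simp add: is_path_append path_end_append)
  qed (rule class_spur[OF *(1-3)])
  show ?thesis
    using elementary_homotopy.spur[of "universal_cover M v" "(v, homotopy_class M v [])" "cover_lift v [] xs"
        "(homotopy_class M v xs, d)" "cover_lift v xs ys"]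
      lift_path[of v "[]" es] spur * l universal_cover_opp[OF *(2,3)]
    by (simp add: lift_append)
next
  case (triangle xs d ys)
  then have *: "is_path M v xs" "d \<in> darts M" "org M d = path_end M v xs" "v \<in> verts M"
    by (auto simp: is_path_append intro: path_start)
  have l: "cover_lift v (xs @ [d, nxt M d, nxt M (nxt M d)]) ys = cover_lift v xs ys"
  proof (rule lift_cong)
    show "is_path M (path_end M v (xs @ [d, nxt M d, nxt M (nxt M d)])) ys"
      using triangle by (simp add: is_path_append path_end_append)
  qed (rule class_triangle[OF *(1-3)])
  have n: "nxt (universal_cover M v) = cover_nxt M v" by (simp add: universal_cover_def)
  show ?thesis
    using elementary_homotopy.triangle[of "universal_cover M v" "(v, homotopy_class M v [])" "cover_lift v [] xs"
        "(homotopy_class M v xs, d)" "cover_lift v xs ys"]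
      lift_path[of v "[]" es] triangle * l cover_nxt3[OF *(1-3)] cover_nxt_class[OF *(2,3)] n
    by (simp add: lift_append)
qed

lemma universal_cover_simply_connected:
  assumes "v \<in> verts M" "is_path (universal_cover M v) (v, homotopy_class M v []) X"
    "path_end (universal_cover M v) (v, homotopy_class M v []) X = (v, homotopy_class M v [])"
  shows "equivclp (elementary_homotopy (universal_cover M v) (v, homotopy_class M v [])) X []"
proof -
  have "equivclp (elementary_homotopy (universal_cover M v) (v, homotopy_class M v []))
      (cover_lift v [] es) (cover_lift v [] es')"
    if "equivclp (elementary_homotopy M v) es es'" for es es'
    using that
    by (induction rule: equivclp_induct)
      (auto dest!: elementary_homotopy_lift intro: equivclp_into_equivclp)
  with path_is_lift[of v "[]" X] assms show ?thesis
    by (metis homotopy_class_eq_iff cover_lift.simps(1) append_Nil is_path.simps(1) path_end.simps(1) prod.inject)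
qed

lemma universal_cover_connected:
  assumes "u \<in> verts (universal_cover M v)" "v \<in> verts M"
  shows "\<exists>X. is_path (universal_cover M v) (v, homotopy_class M v []) X \<and>
    path_end (universal_cover M v) (v, homotopy_class M v []) X = u"
proof -
  obtain es where es: "u = (path_end M v es, homotopy_class M v es)" "is_path M v es"
    using assms by (auto simp: universal_cover_def)
  have *: "is_path (universal_cover M v) (v, homotopy_class M v []) (cover_lift v [] es)"
    using lift_path[of v "[]" es] es assms by simp
  have "map snd (cover_lift v ds es) = es" for ds by (induction es arbitrary: ds) auto
  with path_is_lift[of v "[]", simplified, OF assms(2) *] es * show ?thesis by auto
qed

end

section \<open>Line bundles, holomorphic sections and prolongation\<close>

text \<open>A line subbundle of the trivial bundle is a map to \<open>HP1\<close>, the fibre of \<open>V / L\<close> at \<open>p\<close> is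
  the set of cosets \<open>x +o L p\<close>, and \<open>\<lambda>x. x +o L p\<close> is the canonical projection to it.\<close>

definition immersion :: "('v, 'f, 'd) triangulation \<Rightarrow> ('v \<Rightarrow> quat2 set) \<Rightarrow> bool"
  where "immersion M L \<longleftrightarrow> (\<forall>d\<in>darts M. L (org M d) \<noteq> L (org M (opp M d)))"

definition quotient_section ::
    "('v, 'f, 'd) triangulation \<Rightarrow> ('v \<Rightarrow> quat2 set) \<Rightarrow> ('v \<Rightarrow> quat2 set) \<Rightarrow> bool"
  where "quotient_section M L \<psi> \<longleftrightarrow> (\<forall>v\<in>verts M. \<psi> v \<in> range (\<lambda>x. x +o L v))"

definition holomorphic_section ::
    "('v, 'f, 'd) triangulation \<Rightarrow> ('v \<Rightarrow> quat2 set) \<Rightarrow> ('v \<Rightarrow> quat2 set) \<Rightarrow> bool"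
  where "holomorphic_section M L \<psi> \<longleftrightarrow> quotient_section M L \<psi> \<and>
    (\<forall>b\<in>blacks M. \<exists>x. \<forall>v\<in>verts_of M b. \<psi> v = x +o L v)"

definition prolongation :: "('v, 'f, 'd) triangulation \<Rightarrow> ('v \<Rightarrow> quat2 set) \<Rightarrow>
    ('v \<Rightarrow> quat2 set) \<Rightarrow> 'f \<Rightarrow> quat2"
  where "prolongation M L \<psi> b = (THE x. \<forall>v\<in>verts_of M b. \<psi> v = x +o L v)"

definition obtained_by_prolonging :: "('v, 'f, 'd) triangulation \<Rightarrow> ('v \<Rightarrow> quat2 set) \<Rightarrow>
    ('v \<Rightarrow> quat2 set) \<Rightarrow> ('f \<Rightarrow> quat2 set) \<Rightarrow> bool"
  where "obtained_by_prolonging M L \<psi> L' \<longleftrightarrow> holomorphic_section M L \<psi> \<and>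
    (\<forall>b\<in>blacks M. L' b = qspan (prolongation M L \<psi> b))"

definition nowhere_vanishing ::
    "('v, 'f, 'd) triangulation \<Rightarrow> ('v \<Rightarrow> quat2 set) \<Rightarrow> ('v \<Rightarrow> quat2 set) \<Rightarrow> bool"
  where "nowhere_vanishing M L \<psi> \<longleftrightarrow> (\<forall>v\<in>verts M. \<psi> v \<noteq> 0 +o L v)"

section \<open>Connections over the dual decomposition \<open>M'\<close>\<close>

text \<open>The vertices of \<open>M'\<close> are the black faces of \<open>M\<close>. A white dart \<open>d\<close> represents the edge
  \<open>(face M d, org M d)\<close> of \<open>M'\<close> (the vertices of a white triangle being distinct, its darts
  correspond to its vertices). The two edges of the white triangle at \<open>org M d\<close> are
  \<open>nxt M (nxt M d)\<close> and \<open>d\<close>; the edge of \<open>M'\<close> is directed from the black triangle across the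
  former to the black triangle across the latter.\<close>

definition edge_source :: "('v, 'f, 'd) triangulation \<Rightarrow> 'd \<Rightarrow> 'f"
  where "edge_source M d = face M (opp M (nxt M (nxt M d)))"

definition edge_target :: "('v, 'f, 'd) triangulation \<Rightarrow> 'd \<Rightarrow> 'f"
  where "edge_target M d = face M (opp M d)"

text \<open>The boundary loops of the faces \<open>face M d\<close> and \<open>org M d\<close> of \<open>M'\<close>, starting with the edge
  represented by the white dart \<open>d\<close>. The white and black darts at a vertex alternate, so the
  next white dart at \<open>org M d\<close> is \<open>rot M (rot M d)\<close>.\<close>

definition white_loop :: "('v, 'f, 'd) triangulation \<Rightarrow> 'd \<Rightarrow> 'd list"
  where "white_loop M d = [d, nxt M d, nxt M (nxt M d)]"

definition vertex_loop :: "('v, 'f, 'd) triangulation \<Rightarrow> 'd \<Rightarrow> 'd list"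
  where "vertex_loop M d =
    (let r = rot M \<circ> rot M in map (\<lambda>k. (r ^^ k) d) [0..<(LEAST n. 0 < n \<and> (r ^^ n) d = d)])"

text \<open>A connection assigns to each directed edge of \<open>M'\<close> an isomorphism from the fibre over its
  source to the fibre over its target; along the reversed edge one has the inverse.\<close>

definition is_connection :: "('v, 'f, 'd) triangulation \<Rightarrow> ('f \<Rightarrow> quat2 set) \<Rightarrow>
    ('d \<Rightarrow> quat2 \<Rightarrow> quat2) \<Rightarrow> bool"
  where "is_connection M E P \<longleftrightarrow>
    (\<forall>d\<in>white_darts M. qlinear_iso (E (edge_source M d)) (E (edge_target M d)) (P d))"

definition flat_connection :: "('v, 'f, 'd) triangulation \<Rightarrow> ('f \<Rightarrow> quat2 set) \<Rightarrow>
    ('d \<Rightarrow> quat2 \<Rightarrow> quat2) \<Rightarrow> bool"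
  where "flat_connection M E P \<longleftrightarrow> is_connection M E P \<and>
    (\<forall>d\<in>white_darts M. \<forall>x\<in>E (edge_source M d).
       fold P (white_loop M d) x = x \<and> fold P (vertex_loop M d) x = x)"

definition projection_connection :: "('v, 'f, 'd) triangulation \<Rightarrow> ('v \<Rightarrow> quat2 set) \<Rightarrow>
    ('f \<Rightarrow> quat2 set) \<Rightarrow> 'd \<Rightarrow> quat2 \<Rightarrow> quat2"
  where "projection_connection M L L' d y =
    inv_into (L' (edge_target M d)) (\<lambda>x. x +o L (org M d)) (y +o L (org M d))"

section \<open>The multi ratio condition\<close>

text \<open>\<open>A w\<close> is the projective transformation by which the affine chart used at the white
  triangle \<open>w\<close> is chosen. It has to make the six points involved there finite. A single chart
  for all of \<open>M\<close> is the case of a constant \<open>A\<close>.\<close>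

definition admissible_charts :: "('v, 'f, 'd) triangulation \<Rightarrow> ('v \<Rightarrow> quat2 set) \<Rightarrow>
    ('f \<Rightarrow> quat2 set) \<Rightarrow> ('f \<Rightarrow> quat2 \<Rightarrow> quat2) \<Rightarrow> bool"
  where "admissible_charts M L L' A \<longleftrightarrow>
    (\<forall>w\<in>whites M. qlinear_iso UNIV UNIV (A w)) \<and>
    (\<forall>d\<in>white_darts M. finite_point (A (face M d) ` L (org M d)) \<and>
       finite_point (A (face M d) ` L' (face M (opp M d))))"

lemma admissible_charts_exist:
  assumes "discrete_surface M" "\<forall>v\<in>verts M. L v \<in> HP1" "\<forall>b\<in>blacks M. L' b \<in> HP1"
  shows "\<exists>A. admissible_charts M L L' A"
proof -
  interpret discrete_surface M by fact
  define T where "T q = (\<lambda>z::quat2. (fst z, q * fst z + snd z))" for q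
  have iso: "qlinear_iso UNIV UNIV (T q)" for q
  proof -
    have "bij (T q)"
      by (rule bij_betw_byWitness[where f' = "T (- q)"]) (auto simp: T_def)
    then show ?thesis by (auto simp: qlinear_iso_def T_def rscale_def algebra_simps)
  qed
  have fin: "finite {q. \<not> finite_point (T q ` l)}" if lP: "l \<in> HP1" for l
  proof -
    obtain a b where l: "l = qspan (a, b)" "(a, b) \<noteq> 0" using lP unfolding HP1_def by (auto simp: zero_prod_def)
    have "finite_point (T q ` l)" if "q * a + b \<noteq> 0" for q
    proof -
      define c where "c = q * a + b"
      have "c \<noteq> 0" using that c_def by simp
      have "T q ` l = qspan (a, c)"
        by (auto simp: l qspan_def T_def rscale_def c_def image_iff algebra_simps)
      also have "\<dots> = qspan (a * inverse c, 1)"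
      proof (intro subset_antisym subsetI)
        fix z assume "z \<in> qspan (a, c)"
        then obtain p where "z = (a * p, c * p)" by (auto simp: qspan_def rscale_def)
        then have "z = (a * inverse c, 1) \<cdot> (c * p)"
          using \<open>c \<noteq> 0\<close> by (simp add: rscale_def mult.assoc)
             (simp add: mult.assoc[symmetric])
        then show "z \<in> qspan (a * inverse c, 1)" by (auto simp: qspan_def)
      next
        fix z assume "z \<in> qspan (a * inverse c, 1)"
        then obtain p where "z = (a * inverse c * p, p)" by (auto simp: qspan_def rscale_def)
        then have "z = (a, c) \<cdot> (inverse c * p)"
          using \<open>c \<noteq> 0\<close> by (simp add: rscale_def mult.assoc[symmetric])
        then show "z \<in> qspan (a, c)" by (auto simp: qspan_def)
      qed
      finally show ?thesis by (auto simp: finite_point_def)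
    qed
    then have "{q. \<not> finite_point (T q ` l)} \<subseteq> {q. q * a + b = 0}" by auto
    moreover have "q = - b * inverse a" if "q * a + b = 0" for q
    proof -
      have "a \<noteq> 0" using that l by (auto simp: zero_prod_def)
      have "q * a = - b" using that by (simp add: eq_neg_iff_add_eq_0)
      then show ?thesis using \<open>a \<noteq> 0\<close> by (metis mult.assoc mult.right_neutral right_inverse)
    qed
    then have "{q. q * a + b = 0} \<subseteq> {- b * inverse a}" by auto
    ultimately show ?thesis by (meson finite.emptyI finite.insertI finite_subset)
  qed
  have inf: "infinite (UNIV :: quat set)"
  proof -
    have "inj (\<lambda>r. Quat r 0 0 0)" by (auto simp: inj_def)
    then show ?thesis using infinite_UNIV_char_0 finite_imageD
      by (metis finite_subset subset_UNIV)
  qed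
  have "\<exists>q. \<forall>d\<in>white_darts M. face M d = w \<longrightarrow> finite_point (T q ` L (org M d)) \<and>
      finite_point (T q ` L' (face M (opp M d)))" for w
  proof -
    define D where "D = {d \<in> white_darts M. face M d = w}"
    have "finite D"
    proof (cases "D = {}")
      case False
      then obtain d where "d \<in> D" by blast
      have "D \<subseteq> {d, nxt M d, nxt M (nxt M d)}"
      proof
        fix e assume "e \<in> D"
        with \<open>d \<in> D\<close> have "d \<in> darts M" "e \<in> darts M" "face M d = face M e"
          by (simp_all add: D_def white_darts_def)
        then show "e \<in> {d, nxt M d, nxt M (nxt M d)}" using face_iff[of d e] by blast
      qed
      then show ?thesis by (rule finite_subset) simp
    qed simp
    define B where "B d = {q. \<not> finite_point (T q ` L (org M d))} \<union>
        {q. \<not> finite_point (T q ` L' (face M (opp M d)))}" for d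
    have "finite (B d)" if "d \<in> D" for d
    proof -
      have d: "d \<in> darts M" "face M d \<in> whites M" using that by (auto simp: D_def white_darts_def)
      have "org M d \<in> verts M" using d by (simp add: vertices[symmetric])
      moreover have "face M (opp M d) \<in> blacks M"
        using d color_opp[OF opp_in[OF d(1)]] by (simp add: opp_opp)
      ultimately show ?thesis unfolding B_def using fin assms by simp
    qed
    with \<open>finite D\<close> have "finite (\<Union>d\<in>D. B d)" by blast
    then obtain q where "q \<notin> (\<Union>d\<in>D. B d)"
      using inf by (metis UNIV_I finite_subset subsetI)
    then show ?thesis by (intro exI[of _ q]) (auto simp: D_def B_def)
  qed
  then obtain q where "\<forall>w. \<forall>d\<in>white_darts M. face M d = w \<longrightarrow>
      finite_point (T (q w) ` L (org M d)) \<and> finite_point (T (q w) ` L' (face M (opp M d)))"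
    by metis
  then show ?thesis
    using iso by (intro exI[of _ "\<lambda>w. T (q w)"]) (auto simp: admissible_charts_def)
qed

text \<open>For a white dart \<open>d\<close>, the darts \<open>d\<close>, \<open>nxt M d\<close>, \<open>nxt M (nxt M d)\<close> are the edges
  \<open>12\<close>, \<open>23\<close>, \<open>31\<close> of its white triangle.\<close>

definition multi_ratio_condition :: "('v, 'f, 'd) triangulation \<Rightarrow> ('v \<Rightarrow> quat2 set) \<Rightarrow>
    ('f \<Rightarrow> quat2 set) \<Rightarrow> ('f \<Rightarrow> quat2 \<Rightarrow> quat2) \<Rightarrow> bool"
  where "multi_ratio_condition M L L' A \<longleftrightarrow>
    (\<forall>d\<in>white_darts M.
      let x = (\<lambda>e. affine_coord (A (face M d) ` L (org M e)));
          y = (\<lambda>e. affine_coord (A (face M d) ` L' (face M (opp M e))));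
          d12 = d; d23 = nxt M d; d31 = nxt M (nxt M d)
      in multi_ratio (x d12) (y d12) (x d23) (y d23) (x d31) (y d31) = -1)"

end

theory Submission
  imports Defs
begin

text \<open>All three conditions say the same thing about each white triangle \<open>w\<close>: there are nonzero
  vectors \<open>a\<close>, \<open>b\<close>, \<open>c\<close> in the lines of \<open>L'\<close> at its three black neighbours such that the two
  neighbours containing a vertex \<open>v\<close> of \<open>w\<close> carry vectors that agree modulo \<open>L\<^sub>v\<close> (\<open>closes_up\<close>).

  Since \<open>L'\<^sub>b \<noteq> L\<^sub>v\<close> for a vertex \<open>v\<close> of \<open>b\<close>, every class of \<open>\<bbbH>\<^sup>2 / L\<^sub>v\<close> has exactly one
  representative in \<open>L'\<^sub>b\<close>.

  \<^item> Multi ratio: written in an affine chart, the three agreements are linear equations between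
    scalars. They form a cyclic system, which has a nonzero solution iff a product of six
    factors is \<open>1\<close>; this product is the negative of the multi ratio (\<open>multi_ratio_iff_closes_up\<close>).

  \<^item> Flatness: the holonomy around a vertex \<open>v\<close> is always trivial, because all
    edges at \<open>v\<close> identify the lines with the one fibre \<open>\<bbbH>\<^sup>2 / L\<^sub>v\<close>. The holonomy around \<open>w\<close> is
    a linear map of a line, hence trivial iff it fixes one nonzero vector, and transporting
    that vector gives \<open>a\<close>, \<open>b\<close>, \<open>c\<close> (\<open>flat_iff_closes_up\<close>).

  \<^item> Sections: if \<open>L'\<close> is obtained by prolonging, then the values of the prolongation at the
    neighbours of \<open>w\<close> are such vectors, and white triangles lift to the universal covering
    (\<open>closes_up_if_locally_prolonging\<close>).
    Conversely, an edge of \<open>M\<close> borders exactly one black triangle \<open>b\<close>, and the line \<open>L'\<^sub>b\<close>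
    identifies the fibres of \<open>V / L\<close> at its two end points. This transports a class along edge
    paths of \<open>M\<close>. The transport around a black triangle is trivial because one line is used
    throughout, and around a white triangle by the closing condition. So the result depends
    on the homotopy class of the path only, which is to say that it is a section over the
    universal covering; it is holomorphic with prolongation in \<open>L'\<close> because over a black
    triangle all its values come from one vector of \<open>L'\<^sub>b\<close>
    (\<open>locally_prolonging_if_closes_up\<close>).

  Transport along the edges of \<open>M\<close> replaces parallel transport along the dual edges here because
  the universal covering is built from edge paths of \<open>M\<close>.\<close>

section \<open>Lines in \<open>\<bbbH>\<^sup>2\<close> and their quotients\<close>

lemma rscale_simps [simp]:
  "x \<cdot> 1 = x" "x \<cdot> 0 = 0" "0 \<cdot> q = 0" "x \<cdot> q \<cdot> r = x \<cdot> (q * r)"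
  by (simp_all add: rscale_def zero_prod_def mult.assoc)

lemma rscale_diff: "(x - y) \<cdot> q = x \<cdot> q - y \<cdot> q"
  by (simp add: rscale_def minus_prod_def left_diff_distrib)

text \<open>The functional serves to solve for the scalar in \<open>distinct_lines_span\<close>: over a skew field this
  avoids determinants.\<close>

lemma line_functional:
  assumes "m \<in> HP1"
  shows "\<exists>\<alpha> \<beta>. \<forall>z. z \<in> m \<longleftrightarrow> \<alpha> * fst z + \<beta> * snd z = 0"
proof -
  obtain a b where m: "m = qspan (a, b)" and nz: "(a, b) \<noteq> 0"
    using assms by (auto simp: HP1_def)
  show ?thesis
  proof (cases "b = 0")
    case True
    with nz have "a \<noteq> 0" by (simp add: zero_prod_def)
    have "(x, y) \<in> m \<longleftrightarrow> y = 0" for x y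
    proof
      assume "y = 0"
      then have "(x, y) = (a, b) \<cdot> (inverse a * x)"
        using True \<open>a \<noteq> 0\<close> by (simp add: rscale_def mult.assoc[symmetric])
      then show "(x, y) \<in> m" by (auto simp: m qspan_def)
    qed (use True in \<open>auto simp: m qspan_def rscale_def\<close>)
    then show ?thesis by (intro exI[of _ 0] exI[of _ 1]) auto
  next
    case False
    have "(x, y) \<in> m \<longleftrightarrow> x - a * inverse b * y = 0" for x y
    proof
      assume "x - a * inverse b * y = 0"
      then have "(x, y) = (a, b) \<cdot> (inverse b * y)"
        using False by (simp add: rscale_def mult.assoc[symmetric])
      then show "(x, y) \<in> m" by (auto simp: m qspan_def)
    next
      assume "(x, y) \<in> m"
      then obtain q where "x = a * q" "y = b * q" by (auto simp: m qspan_def rscale_def)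
      moreover have "a * inverse b * (b * q) = a * (inverse b * b) * q" by (simp only: mult.assoc)
      ultimately show "x - a * inverse b * y = 0" using False by simp
    qed
    then show ?thesis by (intro exI[of _ 1] exI[of _ "- (a * inverse b)"]) auto
  qed
qed

lemma line_closed:
  assumes "l \<in> HP1"
  shows line_zero: "0 \<in> l"
    and line_add: "x \<in> l \<Longrightarrow> y \<in> l \<Longrightarrow> x + y \<in> l"
    and line_diff: "x \<in> l \<Longrightarrow> y \<in> l \<Longrightarrow> x - y \<in> l"
    and line_rscale: "x \<in> l \<Longrightarrow> x \<cdot> q \<in> l"
proof -
  obtain p where l: "l = qspan p" using assms by (auto simp: HP1_def)
  show "0 \<in> l" unfolding l qspan_def by (rule range_eqI[of _ _ 0]) simp
  show "x + y \<in> l" if xy: "x \<in> l" "y \<in> l"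
  proof -
    obtain s t where "x = p \<cdot> s" "y = p \<cdot> t" using xy by (auto simp: l qspan_def)
    then have "x + y = p \<cdot> (s + t)" by (simp add: rscale_def plus_prod_def distrib_left)
    then show ?thesis by (simp add: l qspan_def)
  qed
  show "x - y \<in> l" if xy: "x \<in> l" "y \<in> l"
  proof -
    obtain s t where "x = p \<cdot> s" "y = p \<cdot> t" using xy by (auto simp: l qspan_def)
    then have "x - y = p \<cdot> (s - t)" by (simp add: rscale_def minus_prod_def right_diff_distrib)
    then show ?thesis by (simp add: l qspan_def)
  qed
  show "x \<cdot> q \<in> l" if "x \<in> l"
    using that by (auto simp: l qspan_def)
qed

lemma line_diff_commute:
  assumes "l \<in> HP1"
  shows "x - y \<in> l \<longleftrightarrow> y - x \<in> l"
  using line_diff[OF assms line_zero[OF assms], of "x - y"]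
    line_diff[OF assms line_zero[OF assms], of "y - x"] by auto

lemma line_diff_trans:
  assumes "l \<in> HP1" "x - y \<in> l" "y - z \<in> l"
  shows "x - z \<in> l"
  using line_add[OF assms] by simp

lemma line_nonzero: "l \<in> HP1 \<Longrightarrow> \<exists>x\<in>l. x \<noteq> 0"
  by (auto simp: HP1_def qspan_def) (metis rangeI rscale_simps(1))

lemma line_eq_qspan:
  assumes "l \<in> HP1" "x \<in> l" "x \<noteq> 0"
  shows "l = qspan x"
proof -
  obtain p s where l: "l = qspan p" and x: "x = p \<cdot> s"
    using assms by (auto simp: HP1_def qspan_def)
  have "s \<noteq> 0" using x assms(3) by auto
  then have "p \<cdot> t = x \<cdot> (inverse s * t)" for t
    by (simp add: x mult.assoc[symmetric])
  then have "qspan p \<subseteq> qspan x" by (auto simp: qspan_def)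
  moreover have "qspan x \<subseteq> qspan p" by (auto simp: qspan_def x)
  ultimately show ?thesis using l by blast
qed

lemma line_multiple:
  assumes "l \<in> HP1" "x \<in> l" "x \<noteq> 0" "y \<in> l"
  obtains q where "y = x \<cdot> q"
  using assms line_eq_qspan[OF assms(1-3)] by (auto simp: qspan_def)

lemma distinct_lines_meet:
  assumes "l \<in> HP1" "m \<in> HP1" "l \<noteq> m" "x \<in> l" "x \<in> m"
  shows "x = 0"
  using assms line_eq_qspan by metis

lemma distinct_lines_span:
  assumes "l \<in> HP1" "m \<in> HP1" "l \<noteq> m"
  shows "\<exists>y\<in>l. y - z \<in> m"
proof -
  obtain \<alpha> \<beta> where m: "\<And>z. z \<in> m \<longleftrightarrow> \<alpha> * fst z + \<beta> * snd z = 0"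
    using line_functional[OF assms(2)] by auto
  obtain p where p: "p \<in> l" "p \<noteq> 0" using line_nonzero[OF assms(1)] by auto
  define \<phi> where "\<phi> z = \<alpha> * fst z + \<beta> * snd z" for z
  have "\<phi> p \<noteq> 0" using distinct_lines_meet[OF assms p(1)] p(2) m by (auto simp: \<phi>_def)
  have "\<phi> (p \<cdot> s - z) = \<phi> p * s - \<phi> z" for s
    by (simp add: \<phi>_def rscale_def minus_prod_def algebra_simps)
  then have "\<phi> (p \<cdot> (inverse (\<phi> p) * \<phi> z) - z) = 0"
    using \<open>\<phi> p \<noteq> 0\<close> by (simp add: mult.assoc[symmetric])
  then have "p \<cdot> (inverse (\<phi> p) * \<phi> z) - z \<in> m" by (simp add: m \<phi>_def)
  then show ?thesis using line_rscale[OF assms(1) p(1)] by blast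
qed

lemma coset_eq_iff:
  assumes "m \<in> HP1"
  shows "x +o m = y +o m \<longleftrightarrow> x - y \<in> m"
proof
  assume *: "x +o m = y +o m"
  have "x \<in> x +o m" using line_zero[OF assms] by (force simp: elt_set_plus_def)
  then show "x - y \<in> m" unfolding * by (auto simp: elt_set_plus_def)
next
  have "x +o m \<subseteq> y +o m" if "x - y \<in> m" for x y
  proof
    fix z assume "z \<in> x +o m"
    then obtain u where "u \<in> m" "z = x + u" by (auto simp: elt_set_plus_def)
    then have "z = y + ((x - y) + u)" "(x - y) + u \<in> m"
      using line_add[OF assms that] by auto
    then show "z \<in> y +o m" unfolding elt_set_plus_def by blast
  qed
  then show "x - y \<in> m \<Longrightarrow> x +o m = y +o m"
    using line_diff_commute[OF assms] by blast
qed

text \<open>Distinct lines are complementary, so each class modulo one of them has a unique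
  representative in the other; this makes the connection of condition (ii) well defined.\<close>

lemma projection_bij:
  assumes "l \<in> HP1" "m \<in> HP1" "l \<noteq> m"
  shows "bij_betw (\<lambda>x. x +o m) l (range (\<lambda>x. x +o m))"
proof -
  have "inj_on (\<lambda>x. x +o m) l"
  proof (rule inj_onI)
    fix x y assume "x \<in> l" "y \<in> l" "x +o m = y +o m"
    then have "x - y = 0"
      by (intro distinct_lines_meet[OF assms] line_diff[OF assms(1)])
        (simp_all add: coset_eq_iff[OF assms(2)])
    then show "x = y" by simp
  qed
  moreover have "z +o m \<in> (\<lambda>x. x +o m) ` l" for z
    using distinct_lines_span[OF assms, of z] coset_eq_iff[OF assms(2)] by (metis imageI)
  ultimately show ?thesis by (auto simp: bij_betw_def)
qed

lemma inv_projection_eq_iff: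
  assumes "l \<in> HP1" "m \<in> HP1" "l \<noteq> m"
  shows "inv_into l (\<lambda>x. x +o m) (y +o m) = x \<longleftrightarrow> x \<in> l \<and> x - y \<in> m"
proof -
  have "y +o m \<in> (\<lambda>x. x +o m) ` l" and inj: "inj_on (\<lambda>x. x +o m) l"
    using projection_bij[OF assms] by (auto simp: bij_betw_def)
  then show ?thesis
    using f_inv_into_f[of "y +o m" "\<lambda>x. x +o m" l] inv_into_into[of "y +o m" "\<lambda>x. x +o m" l]
      inv_into_f_eq[OF inj] coset_eq_iff[OF assms(2)] by metis
qed

lemma mem_qspan_affine: "z \<in> qspan (x, 1) \<longleftrightarrow> fst z = x * snd z"
  by (cases z) (auto simp: qspan_def rscale_def)

lemma affine_coord:
  assumes "finite_point l"
  shows "l = qspan (affine_coord l, 1)"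
proof -
  obtain x where x: "l = qspan (x, 1)" using assms by (auto simp: finite_point_def)
  have "y = x" if "l = qspan (y, 1)" for y
  proof -
    have "(y, 1) \<in> l" by (simp add: that mem_qspan_affine)
    then show ?thesis by (simp add: x mem_qspan_affine)
  qed
  with x have "affine_coord l = x" unfolding affine_coord_def by (rule the_equality)
  with x show ?thesis by simp
qed

section \<open>The closing condition at a white triangle\<close>

text \<open>The condition through which all three conditions of the theorem are compared. It asks for
  \<open>a \<noteq> 0\<close> only: if the black lines differ from the lines at their vertices, then \<open>b\<close> and \<open>c\<close>
  are nonzero as well, since a vector of one of these lines that agrees with \<open>0\<close> modulo the
  other line is \<open>0\<close>.\<close>

definition closes_up :: "('v, 'f, 'd) triangulation \<Rightarrow> ('v \<Rightarrow> quat2 set) \<Rightarrow>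
    ('f \<Rightarrow> quat2 set) \<Rightarrow> 'd \<Rightarrow> bool"
  where "closes_up M L L' d \<longleftrightarrow>
    (\<exists>a\<in>L' (face M (opp M d)). \<exists>b\<in>L' (face M (opp M (nxt M d))).
     \<exists>c\<in>L' (face M (opp M (nxt M (nxt M d)))).
       a \<noteq> 0 \<and> a - c \<in> L (org M d) \<and> b - a \<in> L (org M (nxt M d)) \<and>
       c - b \<in> L (org M (nxt M (nxt M d))))"

text \<open>Eliminating \<open>\<beta>\<close> and \<open>\<gamma>\<close> leaves \<open>h * (q3 * \<gamma>) = q3 * \<gamma>\<close> with \<open>h\<close> the product on the right,
  so the system has a solution with a nonzero entry iff \<open>h = 1\<close>.\<close>

lemma cyclic_system_solvable_iff:
  fixes p1 p2 p3 q1 q2 q3 :: "'a::division_ring"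
  assumes nz: "p1 \<noteq> 0" "p2 \<noteq> 0" "p3 \<noteq> 0" "q1 \<noteq> 0" "q2 \<noteq> 0" "q3 \<noteq> 0"
  shows "(\<exists>\<alpha> \<beta> \<gamma>. \<alpha> \<noteq> 0 \<and> p1 * \<alpha> = q3 * \<gamma> \<and> p2 * \<beta> = q1 * \<alpha> \<and> p3 * \<gamma> = q2 * \<beta>) \<longleftrightarrow>
    p1 * inverse q1 * p2 * inverse q2 * p3 * inverse q3 = 1"
proof -
  have cancel: "inverse x * (x * y) = y" "x * (inverse x * y) = y" if "x \<noteq> 0" for x y :: 'a
    using that by (simp_all add: mult.assoc[symmetric])
  have turn: "x * y = 1 \<longleftrightarrow> y * x = 1" for x y :: 'a
    by (metis inverse_unique left_inverse mult_eq_0_iff right_inverse zero_neq_one mult_zero_left mult_zero_right)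
  show ?thesis
  proof
    assume "\<exists>\<alpha> \<beta> \<gamma>. \<alpha> \<noteq> 0 \<and> p1 * \<alpha> = q3 * \<gamma> \<and> p2 * \<beta> = q1 * \<alpha> \<and> p3 * \<gamma> = q2 * \<beta>"
    then obtain \<alpha> \<beta> \<gamma> where *: "\<alpha> \<noteq> 0" "p1 * \<alpha> = q3 * \<gamma>" "p2 * \<beta> = q1 * \<alpha>" "p3 * \<gamma> = q2 * \<beta>"
      by auto
    define h where "h = p1 * inverse q1 * p2 * inverse q2 * p3 * inverse q3"
    have "h * (q3 * \<gamma>) = p1 * (inverse q1 * (p2 * (inverse q2 * (p3 * (inverse q3 * (q3 * \<gamma>))))))"
      by (simp add: h_def mult.assoc)
    also have "\<dots> = q3 * \<gamma>" using * nz by (simp add: cancel)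
    finally have "(h - 1) * (q3 * \<gamma>) = 0" by (simp add: left_diff_distrib)
    moreover have "q3 * \<gamma> \<noteq> 0" using * nz by (metis mult_eq_0_iff)
    ultimately show "p1 * inverse q1 * p2 * inverse q2 * p3 * inverse q3 = 1"
      unfolding h_def[symmetric] by simp
  next
    assume "p1 * inverse q1 * p2 * inverse q2 * p3 * inverse q3 = 1"
    then have "(p1 * (inverse q1 * p2 * inverse q2)) * (p3 * inverse q3) = 1"
      by (simp add: mult.assoc)
    then have "(p3 * inverse q3 * p1) * (inverse q1 * p2 * inverse q2) = 1"
      by (subst (asm) turn) (simp add: mult.assoc)
    then have "(p3 * inverse q3 * p1) * (inverse q1 * p2 * inverse q2) * (q2 * (inverse p2 * q1))
        = q2 * (inverse p2 * q1)" by simp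
    then have "p3 * (inverse q3 * p1) = q2 * (inverse p2 * q1)"
      using nz by (simp add: mult.assoc cancel)
    then show "\<exists>\<alpha> \<beta> \<gamma>. \<alpha> \<noteq> 0 \<and> p1 * \<alpha> = q3 * \<gamma> \<and> p2 * \<beta> = q1 * \<alpha> \<and> p3 * \<gamma> = q2 * \<beta>"
      using nz by (intro exI[of _ 1] exI[of _ "inverse p2 * q1"] exI[of _ "inverse q3 * p1"])
        (simp add: cancel)
  qed
qed

text \<open>Three of the six differences of the multi ratio have the opposite sign here, which turns the
  product \<open>1\<close> into \<open>- 1\<close>.\<close>

lemma multi_ratio_eq_iff:
  assumes "y1 \<noteq> x1" "y1 \<noteq> x2" "y2 \<noteq> x2" "y2 \<noteq> x3" "y3 \<noteq> x3" "y3 \<noteq> x1"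
  shows "multi_ratio x1 y1 x2 y2 x3 y3 = - 1 \<longleftrightarrow>
    (\<exists>\<alpha> \<beta> \<gamma>. \<alpha> \<noteq> 0 \<and> (y1 - x1) * \<alpha> = (y3 - x1) * \<gamma> \<and> (y2 - x2) * \<beta> = (y1 - x2) * \<alpha> \<and>
      (y3 - x3) * \<gamma> = (y2 - x3) * \<beta>)"
proof -
  have "multi_ratio x1 y1 x2 y2 x3 y3 =
      - ((y1 - x1) * inverse (y1 - x2) * (y2 - x2) * inverse (y2 - x3) * (y3 - x3) * inverse (y3 - x1))"
    unfolding multi_ratio_def minus_diff_eq[of y1 x1, symmetric] minus_diff_eq[of y2 x2, symmetric]
      minus_diff_eq[of y3 x3, symmetric] by (simp only: mult_minus_left mult_minus_right minus_minus)
  then show ?thesis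
    using cyclic_system_solvable_iff[of "y1 - x1" "y2 - x2" "y3 - x3" "y1 - x2" "y2 - x3" "y3 - x1"]
      assms by (simp only: neg_equal_iff_equal right_minus_eq) blast
qed

text \<open>In the chart, vectors of the three black lines are \<open>(y1, 1) \<cdot> \<alpha>\<close>, \<open>(y2, 1) \<cdot> \<beta>\<close> and
  \<open>(y3, 1) \<cdot> \<gamma>\<close>. Two of them, say the first and the last, agree modulo \<open>qspan (x1, 1)\<close> iff
  \<open>(y1 - x1) * \<alpha> = (y3 - x1) * \<gamma>\<close>, so closing up is the solvability of a cyclic system.\<close>

lemma multi_ratio_closing:
  assumes T: "qlinear_iso UNIV UNIV T"
    and x: "T ` l1 = qspan (x1, 1)" "T ` l2 = qspan (x2, 1)" "T ` l3 = qspan (x3, 1)"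
    and y: "T ` m1 = qspan (y1, 1)" "T ` m2 = qspan (y2, 1)" "T ` m3 = qspan (y3, 1)"
    and ne: "m1 \<noteq> l1" "m1 \<noteq> l2" "m2 \<noteq> l2" "m2 \<noteq> l3" "m3 \<noteq> l3" "m3 \<noteq> l1"
  shows "multi_ratio x1 y1 x2 y2 x3 y3 = - 1 \<longleftrightarrow>
    (\<exists>a\<in>m1. \<exists>b\<in>m2. \<exists>c\<in>m3. a \<noteq> 0 \<and> a - c \<in> l1 \<and> b - a \<in> l2 \<and> c - b \<in> l3)"
proof -
  have bij: "bij T" and add: "\<And>u v. T (u + v) = T u + T v"
    using T by (auto simp: qlinear_iso_def)
  have inj: "inj T" using bij by (rule bij_is_inj)
  have diff: "T (u - v) = T u - T v" for u v using add[of "u - v" v] by simp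
  have zero: "T u = 0 \<longleftrightarrow> u = 0" for u using inj diff[of u u] by (metis diff_self injD)
  have ne': "y1 \<noteq> x1" "y1 \<noteq> x2" "y2 \<noteq> x2" "y2 \<noteq> x3" "y3 \<noteq> x3" "y3 \<noteq> x1"
    using ne x y inj by (metis inj_image_eq_iff)+
  have eqn: "(y \<cdot> s - z \<cdot> t \<in> qspan (x, 1)) \<longleftrightarrow> (fst y - x) * s = (fst z - x) * t"
    if "snd y = 1" "snd z = 1" for y z s t x
    using that by (auto simp: mem_qspan_affine rscale_def algebra_simps)
  have "(\<exists>a\<in>m1. \<exists>b\<in>m2. \<exists>c\<in>m3. a \<noteq> 0 \<and> a - c \<in> l1 \<and> b - a \<in> l2 \<and> c - b \<in> l3) \<longleftrightarrow>
    (\<exists>a\<in>T ` m1. \<exists>b\<in>T ` m2. \<exists>c\<in>T ` m3.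
       a \<noteq> 0 \<and> a - c \<in> T ` l1 \<and> b - a \<in> T ` l2 \<and> c - b \<in> T ` l3)"
    by (simp add: diff[symmetric] inj_image_mem_iff[OF inj] zero)
  also have "\<dots> \<longleftrightarrow> (\<exists>\<alpha> \<beta> \<gamma>. (y1, 1) \<cdot> \<alpha> \<noteq> 0 \<and> (y1, 1) \<cdot> \<alpha> - (y3, 1) \<cdot> \<gamma> \<in> qspan (x1, 1) \<and>
      (y2, 1) \<cdot> \<beta> - (y1, 1) \<cdot> \<alpha> \<in> qspan (x2, 1) \<and> (y3, 1) \<cdot> \<gamma> - (y2, 1) \<cdot> \<beta> \<in> qspan (x3, 1))"
    unfolding x y unfolding qspan_def[of "(y1, 1)"] qspan_def[of "(y2, 1)"] qspan_def[of "(y3, 1)"]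
    by blast
  also have "\<dots> \<longleftrightarrow> (\<exists>\<alpha> \<beta> \<gamma>. \<alpha> \<noteq> 0 \<and> (y1 - x1) * \<alpha> = (y3 - x1) * \<gamma> \<and>
      (y2 - x2) * \<beta> = (y1 - x2) * \<alpha> \<and> (y3 - x3) * \<gamma> = (y2 - x3) * \<beta>)"
    by (simp add: eqn) (auto simp: rscale_def zero_prod_def)
  finally show ?thesis using multi_ratio_eq_iff[OF ne'] by simp
qed

section \<open>Pairs of line bundles over a discrete surface\<close>

text \<open>The assumptions pass from \<open>M\<close> to its universal covering. Transversality is stated for darts
  because darts of the covering project to darts of \<open>M\<close>.\<close>

locale line_bundle_pair = discrete_surface M
  for M :: "('v, 'f, 'd) triangulation" +
  fixes L :: "'v \<Rightarrow> quat2 set" and L' :: "'f \<Rightarrow> quat2 set"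
  assumes L_line: "v \<in> verts M \<Longrightarrow> L v \<in> HP1"
    and imm: "immersion M L"
    and L'_line: "b \<in> blacks M \<Longrightarrow> L' b \<in> HP1"
    and transversal: "\<lbrakk>d \<in> darts M; face M d \<in> blacks M\<rbrakk> \<Longrightarrow> L' (face M d) \<noteq> L (org M d)"

context discrete_surface
begin

lemma black_opp: "d \<in> darts M \<Longrightarrow> face M (opp M d) \<in> blacks M \<longleftrightarrow> face M d \<in> whites M"
  using color_opp[of "opp M d"] by (simp add: opp_in opp_opp)

lemma face_nxt: "d \<in> darts M \<Longrightarrow> face M (nxt M d) = face M d"
  using face_iff[of d "nxt M d"] by (simp add: nxt_in)

lemma not_white_iff: "d \<in> darts M \<Longrightarrow> face M d \<notin> whites M \<longleftrightarrow> face M d \<in> blacks M"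
  using faces colors_disjoint by blast

lemma white_dart_iff: "d \<in> white_darts M \<longleftrightarrow> d \<in> darts M \<and> face M d \<in> whites M"
  by (simp add: white_darts_def)

lemma white_dart_nxt: "d \<in> white_darts M \<Longrightarrow> nxt M d \<in> white_darts M"
  by (simp add: white_darts_def nxt_in face_nxt)

lemma verts_of_face:
  assumes "d \<in> darts M"
  shows "verts_of M (face M d) = {org M d, org M (nxt M d), org M (nxt M (nxt M d))}"
proof -
  have "{d' \<in> darts M. face M d' = face M d} = {d, nxt M d, nxt M (nxt M d)}"
    using face_iff[OF assms] assms by (auto simp: nxt_in face_nxt) (metis insertE singletonD)
  then show ?thesis by (simp add: verts_of_def)
qed

lemma black_dart_at_vertex:
  assumes "v \<in> verts M"
  obtains d where "d \<in> darts M" "face M d \<in> blacks M" "org M d = v"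
proof -
  have "v \<in> org M ` darts M" using assms by (simp only: vertices)
  then obtain d where d: "d \<in> darts M" "org M d = v" by auto
  show ?thesis
  proof (cases "face M d \<in> blacks M")
    case False
    then have "face M (rot M d) \<in> blacks M"
      using d not_white_iff[OF d(1)] by (simp add: rot_def face_nxt opp_in black_opp)
    then show ?thesis using that[of "rot M d"] d rot_pow[OF d(1), of 1] by simp
  qed (use d that in auto)
qed

lemma black_dart_of_face:
  assumes "b \<in> blacks M"
  obtains d where "d \<in> darts M" "face M d = b"
proof -
  have "b \<in> face M ` darts M" using assms faces by blast
  then show ?thesis using that by auto
qed

end

context line_bundle_pair
begin

lemma L_org: "d \<in> darts M \<Longrightarrow> L (org M d) \<in> HP1"
  by (simp add: L_line org_in)

lemma immersion_nxt: "d \<in> darts M \<Longrightarrow> L (org M d) \<noteq> L (org M (nxt M d))"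
  using imm by (simp add: immersion_def org_nxt)

lemma black_side_lines:
  assumes "d \<in> darts M" "face M d \<in> blacks M"
  shows "L' (face M d) \<in> HP1" "L' (face M d) \<noteq> L (org M d)"
    "L' (face M d) \<noteq> L (org M (opp M d))"
  using assms transversal[of d] transversal[of "nxt M d"] L'_line
  by (simp_all add: nxt_in face_nxt org_nxt)

text \<open>Two lines of \<open>L\<close> at adjacent vertices meet in \<open>0\<close> only, so a vector is determined by its
  classes at the vertices of a triangle; this is where the immersion condition enters.\<close>

lemma prolongation_eqI:
  assumes "b \<in> blacks M" and x: "\<forall>v\<in>verts_of M b. \<psi> v = x +o L v"
  shows "prolongation M L \<psi> b = x"
  unfolding prolongation_def
proof (rule the_equality[of _ x])
  fix y assume y: "\<forall>v\<in>verts_of M b. \<psi> v = y +o L v"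
  obtain d where d: "d \<in> darts M" "face M d = b" using black_dart_of_face assms(1) by blast
  have "y - x \<in> L (org M d)" "y - x \<in> L (org M (nxt M d))"
    using x y d verts_of_face[OF d(1)]
    by (simp_all add: coset_eq_iff[symmetric] L_org nxt_in)
  then have "y - x = 0"
    using d(1) by (intro distinct_lines_meet[of "L (org M d)" "L (org M (nxt M d))"])
      (simp_all add: L_org nxt_in immersion_nxt)
  then show "y = x" by simp
qed (use x in auto)

lemma prolongation_agrees:
  assumes "obtained_by_prolonging M L \<psi> L'" "d \<in> darts M" "face M d \<in> blacks M"
  shows "\<psi> (org M d) = prolongation M L \<psi> (face M d) +o L (org M d)"
    "prolongation M L \<psi> (face M d) \<in> L' (face M d)"
    "prolongation M L \<psi> (face M d) \<noteq> 0"
proof -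
  obtain x where x: "\<forall>v\<in>verts_of M (face M d). \<psi> v = x +o L v"
    using assms unfolding obtained_by_prolonging_def holomorphic_section_def by blast
  then show "\<psi> (org M d) = prolongation M L \<psi> (face M d) +o L (org M d)"
    using prolongation_eqI[OF assms(3) x] by (simp add: verts_of_face[OF assms(2)])
  let ?p = "prolongation M L \<psi> (face M d)"
  have L': "L' (face M d) = qspan ?p"
    using assms by (auto simp: obtained_by_prolonging_def)
  have "?p \<cdot> 1 \<in> qspan ?p" unfolding qspan_def by (rule rangeI)
  then show "?p \<in> L' (face M d)" by (simp add: L')
  show "?p \<noteq> 0"
    using line_nonzero[OF L'_line[OF assms(3)]] by (auto simp: L' qspan_def)
qed

lemma nowhere_vanishing_if_prolonging:
  assumes "obtained_by_prolonging M L \<psi> L'"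
  shows "nowhere_vanishing M L \<psi>"
  unfolding nowhere_vanishing_def
proof
  fix v assume v: "v \<in> verts M"
  obtain d where d: "d \<in> darts M" "face M d \<in> blacks M" "org M d = v"
    using black_dart_at_vertex[OF v] .
  note p = prolongation_agrees[OF assms d(1,2)]
  have "prolongation M L \<psi> (face M d) \<notin> L v"
    using distinct_lines_meet[OF L'_line[OF d(2)] L_line[OF v]] transversal[OF d(1,2)] p d(3) by metis
  then show "\<psi> v \<noteq> 0 +o L v"
    using p(1) d(3) coset_eq_iff[OF L_line[OF v], of "prolongation M L \<psi> (face M d)" 0] by simp
qed

text \<open>The three vectors closing up at a white triangle are the values of the prolongation at its
  black neighbours: two of them represent the same value of the section at the vertex shared
  by their triangles.\<close>

lemma closes_up_if_prolonging:
  assumes "obtained_by_prolonging M L \<psi> L'" "d \<in> white_darts M"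
  shows "closes_up M L L' d"
proof -
  define p where "p e = prolongation M L \<psi> (face M (opp M e))" for e
  have p: "p e \<in> L' (face M (opp M e))" "p e \<noteq> 0"
    "\<psi> (org M e) = p e +o L (org M e)" "\<psi> (org M (nxt M e)) = p e +o L (org M (nxt M e))"
    if "e \<in> white_darts M" for e
  proof -
    have e: "e \<in> darts M" "face M (opp M e) \<in> blacks M"
      using that by (simp_all add: white_dart_iff black_opp)
    show "p e \<in> L' (face M (opp M e))" "p e \<noteq> 0"
      "\<psi> (org M (nxt M e)) = p e +o L (org M (nxt M e))"
      using prolongation_agrees[OF assms(1), of "opp M e"] e by (simp_all add: p_def opp_in org_nxt)
    show "\<psi> (org M e) = p e +o L (org M e)"
      using prolongation_agrees(1)[OF assms(1), of "nxt M (opp M e)"] e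
      by (simp add: p_def opp_in nxt_in face_nxt nxt2_opp)
  qed
  have step: "p (nxt M e) - p e \<in> L (org M (nxt M e))" if "e \<in> white_darts M" for e
    using p(4)[OF that] p(3)[OF white_dart_nxt[OF that]] that
    by (simp add: coset_eq_iff[symmetric] L_org nxt_in white_dart_iff)
  have d: "nxt M d \<in> white_darts M" "nxt M (nxt M d) \<in> white_darts M"
    using assms(2) white_dart_nxt by blast+
  show ?thesis
    unfolding closes_up_def
    using p(1,2)[OF assms(2)] p(1)[OF d(1)] p(1)[OF d(2)] step[OF assms(2)] step[OF d(1)] step[OF d(2)]
      assms(2) by (simp add: nxt_nxt_nxt white_dart_iff) blast
qed

end

section \<open>The connection on the dual decomposition\<close>

context line_bundle_pair
begin

lemma edge_lines:
  assumes "d \<in> white_darts M"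
  shows "L (org M d) \<in> HP1"
    "L' (edge_source M d) \<in> HP1" "L' (edge_source M d) \<noteq> L (org M d)"
    "L' (edge_target M d) \<in> HP1" "L' (edge_target M d) \<noteq> L (org M d)"
proof -
  have d: "d \<in> darts M" "face M d \<in> whites M" using assms by (auto simp: white_dart_iff)
  let ?e = "nxt M (nxt M d)"
  have e: "?e \<in> darts M" "face M (opp M ?e) \<in> blacks M"
    using d by (simp_all add: nxt_in black_opp face_nxt)
  show "L (org M d) \<in> HP1" using d by (simp add: L_org)
  show "L' (edge_source M d) \<in> HP1" "L' (edge_source M d) \<noteq> L (org M d)"
    using black_side_lines[OF opp_in[OF e(1)] e(2)] path_end_triangle[OF d(1)]
    by (simp_all add: edge_source_def)
  show "L' (edge_target M d) \<in> HP1" "L' (edge_target M d) \<noteq> L (org M d)"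
    using black_side_lines[of "opp M d"] d by (simp_all add: edge_target_def opp_in black_opp opp_opp)
qed

lemma projection_connection_eq_iff:
  assumes "d \<in> white_darts M"
  shows "projection_connection M L L' d y = x \<longleftrightarrow> x \<in> L' (edge_target M d) \<and> x - y \<in> L (org M d)"
  unfolding projection_connection_def
  using edge_lines[OF assms] by (intro inv_projection_eq_iff)

lemma projection_connection:
  assumes "d \<in> white_darts M"
  shows "projection_connection M L L' d y \<in> L' (edge_target M d)"
    "projection_connection M L L' d y - y \<in> L (org M d)"
  using projection_connection_eq_iff[OF assms] by blast+

text \<open>Additivity and right linearity follow from the uniqueness of the representative. The inverse
  map is the same construction with source and target exchanged.\<close>

lemma projection_connection_is_connection: "is_connection M L' (projection_connection M L L')"
  unfolding is_connection_def
proof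
  fix d assume d: "d \<in> white_darts M"
  let ?E = "L' (edge_source M d)" and ?F = "L' (edge_target M d)" and ?m = "L (org M d)"
  let ?P = "projection_connection M L L' d"
  note lines = edge_lines[OF d]
  note eq = projection_connection_eq_iff[OF d] and P = projection_connection[OF d]
  have "bij_betw ?P ?E ?F"
    unfolding bij_betw_def
  proof
    show "inj_on ?P ?E"
    proof (rule inj_onI)
      fix x y assume xy: "x \<in> ?E" "y \<in> ?E" "?P x = ?P y"
      then have "x - y \<in> ?m"
        using P(2)[of x] P(2)[of y] line_diff_trans[OF lines(1), of x "?P x" y]
          line_diff_commute[OF lines(1)] by metis
      then have "x - y = 0"
        using distinct_lines_meet[OF lines(2,1,3)] line_diff[OF lines(2) xy(1,2)] by blast
      then show "x = y" by simp
    qed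
    have "z \<in> ?P ` ?E" if "z \<in> ?F" for z
    proof -
      obtain y where y: "y \<in> ?E" "y - z \<in> ?m"
        using distinct_lines_span[OF lines(2,1,3)] by blast
      then have "?P y = z" using that eq line_diff_commute[OF lines(1)] by blast
      then show ?thesis using y(1) by blast
    qed
    then show "?P ` ?E = ?F" using P(1) by blast
  qed
  moreover have "?P (x + y) = ?P x + ?P y" for x y
  proof -
    have "?P x + ?P y - (x + y) = (?P x - x) + (?P y - y)" by (simp add: algebra_simps)
    then have "?P x + ?P y - (x + y) \<in> ?m" using line_add[OF lines(1) P(2)[of x] P(2)[of y]] by (simp only:)
    then show ?thesis using line_add[OF lines(4) P(1) P(1)] by (simp add: eq)
  qed
  moreover have "?P (x \<cdot> q) = ?P x \<cdot> q" for x q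
    using P line_rscale[OF lines(1) P(2)[of x], of q] line_rscale[OF lines(4)]
    by (simp add: eq rscale_diff)
  ultimately show "qlinear_iso ?E ?F ?P" by (simp add: qlinear_iso_def)
qed

text \<open>All edges around a vertex \<open>v\<close> use the projection to the same fibre \<open>(V / L)\<^sub>v\<close>, so the
  class in that fibre never changes, and a vector of a line transversal to \<open>L\<^sub>v\<close> is determined by
  its class. Flatness is therefore a condition on the white faces alone.\<close>

lemma vertex_holonomy_trivial:
  assumes d: "d \<in> white_darts M" and x: "x \<in> L' (edge_source M d)"
  shows "fold (projection_connection M L L') (vertex_loop M d) x = x"
proof -
  define r where "r = rot M \<circ> rot M"
  let ?P = "projection_connection M L L'"
  have d': "d \<in> darts M" using d by (simp add: white_dart_iff)
  have r_pow: "(r ^^ n) d = (rot M ^^ (2 * n)) d" for n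
    by (induction n) (simp_all add: r_def)
  have r: "(r ^^ n) d \<in> white_darts M" "org M ((r ^^ n) d) = org M d" for n
  proof -
    have r1: "r e \<in> white_darts M" if "e \<in> white_darts M" for e
    proof -
      have e: "e \<in> darts M" "face M e \<in> whites M" using that by (auto simp: white_dart_iff)
      let ?e = "nxt M (opp M e)"
      have "?e \<in> darts M" "face M ?e \<in> blacks M"
        using e by (simp_all add: nxt_in opp_in face_nxt black_opp)
      then show ?thesis
        using color_opp[of ?e] by (simp add: r_def rot_def white_dart_iff nxt_in opp_in face_nxt)
    qed
    show "(r ^^ n) d \<in> white_darts M" by (induction n) (use d r1 in auto)
    show "org M ((r ^^ n) d) = org M d" using rot_pow[OF d'] by (simp add: r_pow)
  qed
  have edge: "edge_source M (r e) = edge_target M e" if "e \<in> darts M" for e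
    using that by (simp add: edge_source_def edge_target_def r_def rot_def nxt_in opp_in
        nxt_nxt_nxt opp_opp face_nxt)
  \<comment> \<open>The rotation about a vertex is a finite cycle, so some iterate of \<open>r\<close> fixes \<open>d\<close>; only then
    does the least number in the definition of the loop mean anything.\<close>
  define N where "N = (LEAST n. 0 < n \<and> (r ^^ n) d = d)"
  obtain n where "d = (rot M ^^ n) (rot M d)"
    using org_iff[of "rot M d" d] rot_pow[OF d', of 1] d' by auto
  then have n: "(rot M ^^ Suc n) d = d" by (simp add: funpow_swap1)
  have "(rot M ^^ (Suc n * k)) d = d" for k
  proof (induction k)
    case (Suc k)
    then show ?case using n by (simp only: mult_Suc_right funpow_add o_apply)
  qed simp
  then have "0 < Suc n \<and> (r ^^ Suc n) d = d" by (metis r_pow mult.commute zero_less_Suc)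
  then have N: "(r ^^ N) d = d" unfolding N_def by (rule LeastI2) simp
  have inv: "fold ?P (map (\<lambda>k. (r ^^ k) d) [0..<n]) x \<in> L' (edge_source M ((r ^^ n) d)) \<and>
      fold ?P (map (\<lambda>k. (r ^^ k) d) [0..<n]) x - x \<in> L (org M d)" for n
  proof (induction n)
    case 0
    then show ?case using x line_zero[OF L_org[OF d']] by simp
  next
    case (Suc n)
    let ?y = "fold ?P (map (\<lambda>k. (r ^^ k) d) [0..<n]) x" and ?e = "(r ^^ n) d"
    have "?P ?e ?y - x \<in> L (org M d)"
      using line_diff_trans[OF L_org[OF d'], of "?P ?e ?y" ?y x] Suc
        projection_connection(2)[OF r(1)[of n], of ?y] by (simp add: r(2))
    then show ?case
      using projection_connection(1)[OF r(1)[of n], of ?y] r(1)[of n]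
      by (simp add: edge white_dart_iff)
  qed
  let ?z = "fold ?P (vertex_loop M d) x"
  have loop: "vertex_loop M d = map (\<lambda>k. (r ^^ k) d) [0..<N]"
    by (simp add: vertex_loop_def Let_def r_def N_def)
  have z: "?z \<in> L' (edge_source M d)" "?z - x \<in> L (org M d)"
    using inv[of N] N by (simp_all add: loop)
  then have "?z - x = 0"
    using distinct_lines_meet[OF edge_lines(2,1,3)[OF d]] line_diff[OF edge_lines(2)[OF d] z(1) x] by blast
  then show ?thesis by simp
qed

lemma fold_white_loop:
  "fold P (white_loop M d) x = P (nxt M (nxt M d)) (P (nxt M d) (P d x))"
  by (simp add: white_loop_def)

lemma white_edge_ends:
  assumes "d \<in> white_darts M"
  shows "edge_source M (nxt M d) = edge_target M d"
    "edge_target M (nxt M (nxt M d)) = edge_source M d"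
  using assms by (simp_all add: edge_source_def edge_target_def nxt_nxt_nxt white_dart_iff)

text \<open>Parallel transport of one nonzero vector once around a white triangle produces the three
  vectors of the closing condition. Conversely, transport is right linear and the fibres are
  lines, so one nonzero fixed vector suffices.\<close>

lemma white_holonomy_trivial_iff:
  assumes d: "d \<in> white_darts M"
  shows "(\<forall>x\<in>L' (edge_source M d). fold (projection_connection M L L') (white_loop M d) x = x)
    \<longleftrightarrow> closes_up M L L' d"
proof -
  let ?P = "projection_connection M L L'"
  let ?d2 = "nxt M d" and ?d3 = "nxt M (nxt M d)"
  have d2: "?d2 \<in> white_darts M" and d3: "?d3 \<in> white_darts M"
    using d by (simp_all add: white_dart_nxt)
  note ends = white_edge_ends[OF d] white_edge_ends(1)[OF d2]
  have closes: "closes_up M L L' d \<longleftrightarrow>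
    (\<exists>a\<in>L' (edge_target M d). \<exists>b\<in>L' (edge_target M ?d2). \<exists>c\<in>L' (edge_source M d).
       a \<noteq> 0 \<and> a - c \<in> L (org M d) \<and> b - a \<in> L (org M ?d2) \<and> c - b \<in> L (org M ?d3))"
    by (simp add: closes_up_def edge_target_def edge_source_def)
  show ?thesis
  proof
    assume fixed: "\<forall>x\<in>L' (edge_source M d). fold ?P (white_loop M d) x = x"
    obtain c where c: "c \<in> L' (edge_source M d)" "c \<noteq> 0"
      using line_nonzero[OF edge_lines(2)[OF d]] by auto
    define a where "a = ?P d c"
    define b where "b = ?P ?d2 a"
    have "?P ?d3 b = c" using fixed c by (simp add: fold_white_loop a_def b_def)
    then have "c - b \<in> L (org M ?d3)" using projection_connection(2)[OF d3, of b] by simp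
    moreover have a: "a \<in> L' (edge_target M d)" "a - c \<in> L (org M d)"
      using projection_connection[OF d] by (simp_all add: a_def)
    moreover have "b \<in> L' (edge_target M ?d2)" "b - a \<in> L (org M ?d2)"
      using projection_connection[OF d2] by (simp_all add: b_def)
    moreover have "a \<noteq> 0"
    proof
      assume "a = 0"
      then have "c \<in> L (org M d)"
        using a(2) line_diff_commute[OF edge_lines(1)[OF d], of a c] by simp
      then show False using distinct_lines_meet[OF edge_lines(2,1,3)[OF d] c(1)] c(2) by simp
    qed
    ultimately show "closes_up M L L' d" unfolding closes using c(1) by blast
  next
    assume "closes_up M L L' d"
    then obtain a b c where abc: "a \<in> L' (edge_target M d)" "b \<in> L' (edge_target M ?d2)"
      "c \<in> L' (edge_source M d)" "a \<noteq> 0"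
      "a - c \<in> L (org M d)" "b - a \<in> L (org M ?d2)" "c - b \<in> L (org M ?d3)"
      unfolding closes by blast
    have "c \<noteq> 0"
      using distinct_lines_meet[OF edge_lines(4,1,5)[OF d] abc(1)] abc(4,5) by auto
    show "\<forall>x\<in>L' (edge_source M d). fold ?P (white_loop M d) x = x"
    proof
      fix x assume "x \<in> L' (edge_source M d)"
      then obtain q where x: "x = c \<cdot> q"
        using line_multiple[OF edge_lines(2)[OF d] abc(3) \<open>c \<noteq> 0\<close>] by blast
      have step: "?P e (u \<cdot> q) = v \<cdot> q"
        if "e \<in> white_darts M" "v \<in> L' (edge_target M e)" "v - u \<in> L (org M e)" for e u v
        using that line_rscale[OF edge_lines(1)[OF that(1)] that(3), of q]
          line_rscale[OF edge_lines(4)[OF that(1)] that(2), of q]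
        by (simp add: projection_connection_eq_iff rscale_diff)
      show "fold ?P (white_loop M d) x = x"
        using step[OF d abc(1,5)] step[OF d2 abc(2,6)] step[OF d3 _ abc(7)] abc(3)
        by (simp add: fold_white_loop x ends)
    qed
  qed
qed

lemma flat_iff_closes_up:
  "flat_connection M L' (projection_connection M L L') \<longleftrightarrow> (\<forall>d\<in>white_darts M. closes_up M L L' d)"
  unfolding flat_connection_def
  using projection_connection_is_connection vertex_holonomy_trivial white_holonomy_trivial_iff by blast

lemma multi_ratio_iff_closes_up:
  assumes A: "admissible_charts M L L' A"
  shows "multi_ratio_condition M L L' A \<longleftrightarrow> (\<forall>d\<in>white_darts M. closes_up M L L' d)"
proof -
  have "(let x = (\<lambda>e. affine_coord (A (face M d) ` L (org M e)));
          y = (\<lambda>e. affine_coord (A (face M d) ` L' (face M (opp M e))));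
          d12 = d; d23 = nxt M d; d31 = nxt M (nxt M d)
      in multi_ratio (x d12) (y d12) (x d23) (y d23) (x d31) (y d31) = -1) \<longleftrightarrow> closes_up M L L' d"
    if d: "d \<in> white_darts M" for d
  proof -
    let ?d2 = "nxt M d" and ?d3 = "nxt M (nxt M d)"
    have ds: "?d2 \<in> white_darts M" "?d3 \<in> white_darts M"
      using d by (simp_all add: white_dart_nxt)
    have dd: "d \<in> darts M" "face M d \<in> whites M" "face M ?d2 = face M d" "face M ?d3 = face M d"
      using d by (simp_all add: white_dart_iff face_nxt nxt_in)
    have T: "qlinear_iso UNIV UNIV (A (face M d))"
      using A dd(2) by (simp add: admissible_charts_def)
    have fin: "finite_point (A (face M d) ` L (org M e))"
      "finite_point (A (face M d) ` L' (face M (opp M e)))"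
      if "e \<in> {d, ?d2, ?d3}" for e
      using A d ds dd that unfolding admissible_charts_def by (metis insertE singletonD)+
    have ne: "L' (face M (opp M e)) \<noteq> L (org M e)" "L' (face M (opp M e)) \<noteq> L (org M (nxt M e))"
      if "e \<in> white_darts M" for e
      using edge_lines(5)[OF that] edge_lines(3)[OF white_dart_nxt[OF that]] white_edge_ends(1)[OF that]
      by (simp_all add: edge_target_def)
    show ?thesis
      unfolding Let_def closes_up_def
      by (rule multi_ratio_closing[OF T])
        (use ne[OF d] ne[OF ds(1)] ne[OF ds(2)] in
          \<open>simp_all add: affine_coord[symmetric] fin nxt_nxt_nxt dd(1)\<close>)
  qed
  then show ?thesis by (simp add: multi_ratio_condition_def Let_def)
qed

end

section \<open>Transport of the quotient bundle along the edges\<close>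

context discrete_surface
begin

definition black_side :: "'d \<Rightarrow> 'f"
  where "black_side d = (if face M d \<in> blacks M then face M d else face M (opp M d))"

lemma black_side_black: "d \<in> darts M \<Longrightarrow> black_side d \<in> blacks M"
  using not_white_iff by (auto simp: black_side_def black_opp)

lemma black_side_opp: "d \<in> darts M \<Longrightarrow> black_side (opp M d) = black_side d"
  using not_white_iff[of d] color_opp[of d] colors_disjoint
  by (auto simp: black_side_def black_opp opp_opp)

lemma black_side_eq:
  assumes "d \<in> darts M"
  shows "face M d \<in> blacks M \<Longrightarrow> black_side d = face M d"
    "face M d \<in> whites M \<Longrightarrow> black_side d = face M (opp M d)"
  using colors_disjoint by (auto simp: black_side_def)

text \<open>Homotopies of edge paths are generated by spurs and triangles, so invariance needs to be
  checked on these two moves only.\<close>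

lemma fold_homotopy_invariant:
  assumes closed: "\<And>d x. d \<in> darts M \<Longrightarrow> x \<in> F (org M d) \<Longrightarrow> T d x \<in> F (org M (opp M d))"
    and spur: "\<And>d x. d \<in> darts M \<Longrightarrow> x \<in> F (org M d) \<Longrightarrow> T (opp M d) (T d x) = x"
    and triangle: "\<And>d x. d \<in> darts M \<Longrightarrow> x \<in> F (org M d) \<Longrightarrow>
      T (nxt M (nxt M d)) (T (nxt M d) (T d x)) = x"
    and x: "x \<in> F v"
  shows fold_in_fibre: "is_path M v ds \<Longrightarrow> fold T ds x \<in> F (path_end M v ds)"
    and fold_homotopic: "is_path M v ds \<Longrightarrow> equivclp (elementary_homotopy M v) ds ds' \<Longrightarrow>
      fold T ds x = fold T ds' x"
proof -
  show in_fibre: "fold T ds x \<in> F (path_end M v ds)" if "is_path M v ds" for ds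
    using that x by (induction ds arbitrary: v x) (auto intro: closed)
  have move: "fold T es x = fold T es' x" if "elementary_homotopy M v es es'" for es es'
    using that
  proof cases
    case (spur xs d ys)
    then have "d \<in> darts M" "fold T xs x \<in> F (org M d)"
      using in_fibre[of xs] by (auto simp: is_path_append)
    then show ?thesis using spur assms(2) by simp
  next
    case (triangle xs d ys)
    then have "d \<in> darts M" "fold T xs x \<in> F (org M d)"
      using in_fibre[of xs] by (auto simp: is_path_append)
    then show ?thesis using triangle assms(3) by simp
  qed
  show "equivclp (elementary_homotopy M v) ds ds' \<Longrightarrow> fold T ds x = fold T ds' x"
    by (induction rule: equivclp_induct) (auto dest: move)
qed

end

context line_bundle_pair
begin

text \<open>The values at \<open>v\<close> that a nowhere vanishing section of \<open>V / L\<close> can take.\<close>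

definition nonzero_fibre :: "'v \<Rightarrow> quat2 set set"
  where "nonzero_fibre v = (\<lambda>x. x +o L v) ` (- L v)"

text \<open>Every edge borders exactly one black triangle \<open>b\<close>, and both end points are vertices of
  \<open>b\<close>; so \<open>L'\<^sub>b\<close> identifies the fibres of \<open>V / L\<close> at the two end points.\<close>

definition transport :: "'d \<Rightarrow> quat2 set \<Rightarrow> quat2 set"
  where "transport d c =
    inv_into (L' (black_side d)) (\<lambda>x. x +o L (org M d)) c +o L (org M (opp M d))"

lemma black_side_transversal:
  assumes "d \<in> darts M"
  shows "L' (black_side d) \<in> HP1" "L' (black_side d) \<noteq> L (org M d)"
    "L' (black_side d) \<noteq> L (org M (opp M d))"
proof -
  have "L' (face M d) \<noteq> L (org M d) \<and> L' (face M d) \<noteq> L (org M (opp M d))"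
    if "face M d \<in> blacks M"
    using black_side_lines[OF assms that] by blast
  moreover have "L' (face M (opp M d)) \<noteq> L (org M d) \<and> L' (face M (opp M d)) \<noteq> L (org M (opp M d))"
    if "face M (opp M d) \<in> blacks M"
    using black_side_lines[OF opp_in[OF assms] that] assms by (simp add: opp_opp)
  ultimately show "L' (black_side d) \<noteq> L (org M d)" "L' (black_side d) \<noteq> L (org M (opp M d))"
    using black_side_black[OF assms] by (auto simp: black_side_def split: if_splits)
qed (simp add: L'_line black_side_black assms)

lemma transport_eq:
  assumes "d \<in> darts M" "y \<in> L' (black_side d)"
  shows "transport d (y +o L (org M d)) = y +o L (org M (opp M d))"
proof -
  have "inv_into (L' (black_side d)) (\<lambda>x. x +o L (org M d)) (y +o L (org M d)) = y"
    using assms line_zero[OF L_org[OF assms(1)]]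
    by (simp add: inv_projection_eq_iff black_side_transversal L_org)
  then show ?thesis by (simp add: transport_def)
qed

lemma nonzero_fibreE:
  assumes "l \<in> HP1" "v \<in> verts M" "l \<noteq> L v" "c \<in> nonzero_fibre v"
  obtains y where "y \<in> l" "y \<noteq> 0" "c = y +o L v"
proof -
  obtain x where x: "x \<notin> L v" "c = x +o L v" using assms(4) by (auto simp: nonzero_fibre_def)
  obtain y where y: "y \<in> l" "y - x \<in> L v"
    using distinct_lines_span[OF assms(1) L_line assms(3)] assms(2) by blast
  have "y \<noteq> 0" using y(2) x(1) line_diff_commute[OF L_line[OF assms(2)], of y x] by auto
  moreover have "c = y +o L v" using x y by (simp add: coset_eq_iff L_line assms(2) line_diff_commute)
  ultimately show ?thesis using that y(1) by blast
qed

lemma nonzero_fibreI: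
  assumes "l \<in> HP1" "v \<in> verts M" "l \<noteq> L v" "y \<in> l" "y \<noteq> 0"
  shows "y +o L v \<in> nonzero_fibre v"
  using distinct_lines_meet[OF assms(1) L_line[OF assms(2)] assms(3,4)] assms(5)
  by (auto simp: nonzero_fibre_def)

lemma transport_in_fibre:
  assumes d: "d \<in> darts M" and c: "c \<in> nonzero_fibre (org M d)"
  shows "transport d c \<in> nonzero_fibre (org M (opp M d))"
proof -
  obtain y where y: "y \<in> L' (black_side d)" "y \<noteq> 0" "c = y +o L (org M d)"
    using nonzero_fibreE[OF black_side_transversal(1)[OF d] org_in[OF d]
        black_side_transversal(2)[OF d] c] .
  then show ?thesis
    using black_side_transversal[OF d] d
    by (simp add: transport_eq nonzero_fibreI org_in opp_in)
qed

lemma transport_spur: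
  assumes d: "d \<in> darts M" and c: "c \<in> nonzero_fibre (org M d)"
  shows "transport (opp M d) (transport d c) = c"
proof -
  obtain y where y: "y \<in> L' (black_side d)" "y \<noteq> 0" "c = y +o L (org M d)"
    using nonzero_fibreE[OF black_side_transversal(1)[OF d] org_in[OF d]
        black_side_transversal(2)[OF d] c] .
  then show ?thesis
    using transport_eq[OF d] transport_eq[OF opp_in[OF d], of y] d
    by (simp add: black_side_opp opp_opp)
qed

lemma transport_black_triangle:
  assumes d: "d \<in> darts M" "face M d \<in> blacks M" and y: "y \<in> L' (face M d)"
  shows "transport d (y +o L (org M d)) = y +o L (org M (nxt M d))"
    "transport (nxt M d) (y +o L (org M (nxt M d))) = y +o L (org M (nxt M (nxt M d)))"
    "transport (nxt M (nxt M d)) (y +o L (org M (nxt M (nxt M d)))) = y +o L (org M d)"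
  using transport_eq[of d y] transport_eq[of "nxt M d" y] transport_eq[of "nxt M (nxt M d)" y] assms
  by (simp_all add: black_side_eq nxt_in face_nxt org_nxt[symmetric] nxt_nxt_nxt)

text \<open>Around a black triangle all three edges use the same line. Around a white triangle, the
  closing condition gives three vectors, one in each line, that, after
  multiplication by a common scalar, represent a given class and its transports.\<close>

lemma transport_triangle:
  assumes closes: "\<forall>d\<in>white_darts M. closes_up M L L' d"
    and d: "d \<in> darts M" and c: "c \<in> nonzero_fibre (org M d)"
  shows "transport (nxt M (nxt M d)) (transport (nxt M d) (transport d c)) = c"
proof -
  obtain y where y: "y \<in> L' (black_side d)" "y \<noteq> 0" "c = y +o L (org M d)"
    using nonzero_fibreE[OF black_side_transversal(1)[OF d] org_in[OF d]
        black_side_transversal(2)[OF d] c] .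
  let ?d2 = "nxt M d" and ?d3 = "nxt M (nxt M d)"
  show ?thesis
  proof (cases "face M d \<in> blacks M")
    case True
    then show ?thesis using transport_black_triangle[OF d True, of y] y d by (simp add: black_side_eq)
  next
    case False
    then have w: "face M d \<in> whites M" using not_white_iff[OF d] by blast
    then have sides: "black_side d = face M (opp M d)" "black_side ?d2 = face M (opp M ?d2)"
      "black_side ?d3 = face M (opp M ?d3)"
      using d by (simp_all add: black_side_eq nxt_in face_nxt)
    have "closes_up M L L' d" using closes d w by (simp add: white_dart_iff)
    then obtain a b c' where abc: "a \<in> L' (black_side d)" "b \<in> L' (black_side ?d2)" "c' \<in> L' (black_side ?d3)"
      "a \<noteq> 0" "a - c' \<in> L (org M d)" "b - a \<in> L (org M ?d2)" "c' - b \<in> L (org M ?d3)"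
      unfolding sides closes_up_def by blast
    obtain q where q: "y = a \<cdot> q"
      using line_multiple[OF black_side_transversal(1)[OF d] abc(1,4) y(1)] .
    have mult: "u \<cdot> q +o L (org M e) = v \<cdot> q +o L (org M e)"
      if "e \<in> darts M" "u - v \<in> L (org M e)" for e u v
      using line_rscale[OF L_org[OF that(1)] that(2), of q] L_org[OF that(1)]
      by (simp add: coset_eq_iff rscale_diff)
    have tr: "transport e (u \<cdot> q +o L (org M e)) = u \<cdot> q +o L (org M (nxt M e))"
      if "e \<in> darts M" "u \<in> L' (black_side e)" for e u
      using transport_eq[OF that(1) line_rscale[OF black_side_transversal(1)[OF that(1)] that(2)], of q] that
      by (simp add: org_nxt)
    have "transport d c = b \<cdot> q +o L (org M ?d2)"
      using tr[OF d abc(1)] mult[OF nxt_in[OF d] abc(6)] by (simp add: y(3) q)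
    moreover have "transport ?d2 (b \<cdot> q +o L (org M ?d2)) = c' \<cdot> q +o L (org M ?d3)"
      using tr[OF nxt_in[OF d] abc(2)] mult[OF nxt_in[OF nxt_in[OF d]] abc(7)] by simp
    moreover have "transport ?d3 (c' \<cdot> q +o L (org M ?d3)) = c"
      using tr[OF nxt_in[OF nxt_in[OF d]] abc(3)] mult[OF d abc(5)] d by (simp add: y(3) q nxt_nxt_nxt)
    ultimately show ?thesis by simp
  qed
qed

end

section \<open>Sections over the universal covering\<close>

context discrete_surface
begin

lemma cover_simps [simp]:
  "darts (universal_cover M p) = cover_darts M p"
  "org (universal_cover M p) x = (org M (snd x), fst x)"
  "fst (face (universal_cover M p) x) = face M (snd x)"
  "snd (opp (universal_cover M p) x) = opp M (snd x)"
  "snd (nxt (universal_cover M p) x) = nxt M (snd x)"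
  by (simp_all add: universal_cover_def cover_face_def cover_nxt_def split: prod.split)

lemma cover_color_iff:
  assumes "x \<in> cover_darts M p"
  shows "face (universal_cover M p) x \<in> blacks (universal_cover M p) \<longleftrightarrow> face M (snd x) \<in> blacks M"
    "face (universal_cover M p) x \<in> whites (universal_cover M p) \<longleftrightarrow> face M (snd x) \<in> whites M"
  using assms by (auto simp: universal_cover_def cover_face_def)

lemma cover_blacks: "b \<in> blacks (universal_cover M p) \<Longrightarrow> fst b \<in> blacks M"
  by (auto simp: universal_cover_def cover_face_def)

lemma cover_verts:
  assumes "u \<in> verts (universal_cover M p)"
  obtains ds where "is_path M p ds" "u = (path_end M p ds, homotopy_class M p ds)"
  using assms by (auto simp: universal_cover_def)

lemma path_end_in: "is_path M v ds \<Longrightarrow> path_end M v ds \<in> verts M"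
  by (induction ds arbitrary: v) auto

lemma closes_up_cover:
  "closes_up (universal_cover M p) (L \<circ> fst) (L' \<circ> fst) x \<longleftrightarrow> closes_up M L L' (snd x)"
  by (simp add: closes_up_def)

end

context line_bundle_pair
begin

lemma cover_line_bundle_pair:
  assumes "p \<in> verts M"
  shows "line_bundle_pair (universal_cover M p) (L \<circ> fst) (L' \<circ> fst)"
proof -
  interpret U: discrete_surface "universal_cover M p"
    using universal_cover_discrete_surface[OF assms] .
  have dart: "snd x \<in> darts M" if "x \<in> cover_darts M p" for x
    using that by (auto simp: cover_darts_def)
  show ?thesis
  proof unfold_locales
    show "(L \<circ> fst) u \<in> HP1" if "u \<in> verts (universal_cover M p)" for u
      using cover_verts[OF that] L_line path_end_in by (metis comp_apply fst_conv)
    show "immersion (universal_cover M p) (L \<circ> fst)"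
      using imm dart by (simp add: immersion_def)
    show "(L' \<circ> fst) b \<in> HP1" if "b \<in> blacks (universal_cover M p)" for b
      using cover_blacks[OF that] L'_line by simp
    show "(L' \<circ> fst) (face (universal_cover M p) x) \<noteq> (L \<circ> fst) (org (universal_cover M p) x)"
      if "x \<in> darts (universal_cover M p)"
        "face (universal_cover M p) x \<in> blacks (universal_cover M p)" for x
      using that transversal[OF dart] cover_color_iff(1) by simp
  qed
qed

lemma closes_up_if_locally_prolonging:
  assumes "\<forall>p\<in>verts M. \<exists>\<psi>. obtained_by_prolonging (universal_cover M p) (L \<circ> fst) \<psi> (L' \<circ> fst)"
    and d: "d \<in> white_darts M"
  shows "closes_up M L L' d"
proof -
  have d': "d \<in> darts M" "face M d \<in> whites M" using d by (auto simp: white_dart_iff)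
  define p where "p = org M d"
  have p: "p \<in> verts M" using d' by (simp add: p_def org_in)
  interpret U: line_bundle_pair "universal_cover M p" "L \<circ> fst" "L' \<circ> fst"
    using cover_line_bundle_pair[OF p] .
  obtain \<psi> where \<psi>: "obtained_by_prolonging (universal_cover M p) (L \<circ> fst) \<psi> (L' \<circ> fst)"
    using assms p by blast
  define x where "x = (homotopy_class M p [], d)"
  have x: "x \<in> cover_darts M p" unfolding x_def by (rule cover_dartI) (simp_all add: p d' p_def[symmetric])
  then have "x \<in> white_darts (universal_cover M p)"
    using d' cover_color_iff(2)[OF x] by (simp add: white_darts_def) (simp add: x_def)
  from U.closes_up_if_prolonging[OF \<psi> this] show ?thesis
    by (simp add: closes_up_cover) (simp add: x_def)
qed

text \<open>A section over the universal covering is a homotopy invariant assignment of values to edge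
  paths. Transporting one nonzero class along all edge paths gives such an assignment, and
  over a black triangle \<open>b\<close> all its values are classes of one vector of \<open>L'\<^sub>b\<close>.\<close>

lemma locally_prolonging_if_closes_up:
  assumes closes: "\<forall>d\<in>white_darts M. closes_up M L L' d" and p: "p \<in> verts M"
  shows "\<exists>\<psi>. obtained_by_prolonging (universal_cover M p) (L \<circ> fst) \<psi> (L' \<circ> fst)"
proof -
  let ?U = "universal_cover M p"
  interpret U: line_bundle_pair ?U "L \<circ> fst" "L' \<circ> fst"
    using cover_line_bundle_pair[OF p] .
  obtain d0 where d0: "d0 \<in> darts M" "face M d0 \<in> blacks M" "org M d0 = p"
    using black_dart_at_vertex[OF p] .
  obtain x0 where "x0 \<in> L' (face M d0)" "x0 \<noteq> 0" using line_nonzero[OF L'_line[OF d0(2)]] by blast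
  then obtain c0 where c0: "c0 \<in> nonzero_fibre p"
    using nonzero_fibreI[OF L'_line[OF d0(2)] p] transversal[OF d0(1,2)] d0(3) by blast
  have fibre: "fold transport ds c0 \<in> nonzero_fibre (path_end M p ds)" if "is_path M p ds" for ds
    using fold_in_fibre[where T = transport and F = nonzero_fibre, OF _ _ _ c0 that]
      transport_in_fibre transport_spur transport_triangle[OF closes] by blast
  have homotopic: "fold transport ds c0 = fold transport ds' c0"
    if "is_path M p ds" "equivclp (elementary_homotopy M p) ds ds'" for ds ds'
    using fold_homotopic[where T = transport and F = nonzero_fibre, OF _ _ _ c0 that]
      transport_in_fibre transport_spur transport_triangle[OF closes] by blast
  define \<psi> where "\<psi> u = fold transport (SOME ds. ds \<in> snd u) c0" for u :: "'v \<times> 'd list set"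
  have \<psi>: "\<psi> (v, homotopy_class M p ds) = fold transport ds c0" if "is_path M p ds" for v ds
  proof -
    have "ds \<in> homotopy_class M p ds" by (simp add: homotopy_class_def)
    then have "(SOME ds'. ds' \<in> homotopy_class M p ds) \<in> homotopy_class M p ds" by (rule someI)
    then have "equivclp (elementary_homotopy M p) ds (SOME ds'. ds' \<in> homotopy_class M p ds)"
      by (simp add: homotopy_class_def)
    from homotopic[OF that this] show ?thesis by (simp add: \<psi>_def)
  qed
  have fibrewise: "\<psi> u \<in> range (\<lambda>x. x +o (L \<circ> fst) u)" if u: "u \<in> verts ?U" for u
  proof -
    obtain ds where ds: "is_path M p ds" "u = (path_end M p ds, homotopy_class M p ds)"
      using cover_verts[OF u] .
    show ?thesis using fibre[OF ds(1)] \<psi>[OF ds(1)] ds(2) by (auto simp: nonzero_fibre_def)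
  qed
  have black: "\<exists>y. y \<in> L' (fst b) \<and> y \<noteq> 0 \<and> (\<forall>u\<in>verts_of ?U b. \<psi> u = y +o (L \<circ> fst) u)"
    if b: "b \<in> blacks ?U" for b
  proof -
    obtain x where x: "x \<in> cover_darts M p" "face ?U x = b"
      using U.black_dart_of_face[OF b] by auto
    obtain ds d where d: "x = (homotopy_class M p ds, d)" "is_path M p ds" "d \<in> darts M"
      "org M d = path_end M p ds" using x(1) by (rule cover_dartE)
    have fb: "fst b = face M d" using x(2) cover_simps(3)[of p x] d(1) by simp
    have bl: "face M d \<in> blacks M" using cover_blacks[OF b] fb by simp
    obtain y where y: "y \<in> L' (face M d)" "y \<noteq> 0" "fold transport ds c0 = y +o L (org M d)"
      using nonzero_fibreE[OF L'_line[OF bl] org_in[OF d(3)] transversal[OF d(3) bl]]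
        fibre[OF d(2)] d(4) by metis
    have paths: "is_path M p (ds @ [d])" "is_path M p (ds @ [d, nxt M d])"
      using d by (simp_all add: is_path_append org_in opp_in nxt_in org_nxt)
    have classes: "fst x = homotopy_class M p ds" "snd x = d"
      "fst (nxt ?U x) = homotopy_class M p (ds @ [d])"
      "fst (nxt ?U (nxt ?U x)) = homotopy_class M p (ds @ [d, nxt M d])"
      using cover_nxt_class[OF d(3,4)] cover_nxt3(1)[OF d(2-4)] d(1) by (simp_all add: universal_cover_def)
    have "verts_of ?U b = {(org M d, homotopy_class M p ds),
        (org M (nxt M d), homotopy_class M p (ds @ [d])),
        (org M (nxt M (nxt M d)), homotopy_class M p (ds @ [d, nxt M d]))}"
      using U.verts_of_face[of x] x by (simp add: classes)
    moreover have "\<psi> (v, homotopy_class M p ds) = y +o L (org M d)" for v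
      using \<psi>[OF d(2)] y(3) by simp
    moreover have "\<psi> (v, homotopy_class M p (ds @ [d])) = y +o L (org M (nxt M d))" for v
      using \<psi>[OF paths(1)] y(3) transport_black_triangle(1)[OF d(3) bl y(1)] by simp
    moreover have "\<psi> (v, homotopy_class M p (ds @ [d, nxt M d])) = y +o L (org M (nxt M (nxt M d)))" for v
      using \<psi>[OF paths(2)] y(3) transport_black_triangle(1,2)[OF d(3) bl y(1)] by simp
    ultimately have "\<forall>u\<in>verts_of ?U b. \<psi> u = y +o (L \<circ> fst) u" by simp
    then show ?thesis using y(1,2) fb by (intro exI[of _ y]) simp
  qed
  have "(L' \<circ> fst) b = qspan (prolongation ?U (L \<circ> fst) \<psi> b)" if b: "b \<in> blacks ?U" for b
  proof -
    obtain y where y: "y \<in> L' (fst b)" "y \<noteq> 0" "\<forall>u\<in>verts_of ?U b. \<psi> u = y +o (L \<circ> fst) u"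
      using black[OF b] by blast
    show ?thesis
      using line_eq_qspan[OF L'_line[OF cover_blacks[OF b]] y(1,2)] U.prolongation_eqI[OF b y(3)] by simp
  qed
  then have "obtained_by_prolonging ?U (L \<circ> fst) \<psi> (L' \<circ> fst)"
    using fibrewise black unfolding obtained_by_prolonging_def holomorphic_section_def quotient_section_def
    by blast
  then show ?thesis by blast
qed

end

section \<open>The equivalence of the three conditions\<close>

theorem theorem3p2:
  fixes M :: "('v, 'f, 'd) triangulation"
    and L :: "'v \<Rightarrow> quat2 set"
    and L' :: "'f \<Rightarrow> quat2 set"
    and A :: "'f \<Rightarrow> quat2 \<Rightarrow> quat2"
  assumes "discrete_surface M"
    and "\<forall>v\<in>verts M. L v \<in> HP1"
    and "immersion M L"
    and "\<forall>b\<in>blacks M. L' b \<in> HP1"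
    and "\<forall>b\<in>blacks M. \<forall>v\<in>verts_of M b. L' b \<noteq> L v"
    and "admissible_charts M L L' A"
  shows "(multi_ratio_condition M L L' A \<longleftrightarrow>
            flat_connection M L' (projection_connection M L L')) \<and>
         (flat_connection M L' (projection_connection M L L') \<longleftrightarrow>
            (\<forall>p\<in>verts M. \<exists>\<psi>. obtained_by_prolonging (universal_cover M p) (L \<circ> fst) \<psi> (L' \<circ> fst))) \<and>
         (\<forall>p\<in>verts M. \<forall>\<psi>. obtained_by_prolonging (universal_cover M p) (L \<circ> fst) \<psi> (L' \<circ> fst) \<longrightarrow>
            nowhere_vanishing (universal_cover M p) (L \<circ> fst) \<psi>)"
proof -
  interpret discrete_surface M by fact
  interpret line_bundle_pair M L L'
    by unfold_locales (use assms in \<open>auto simp: verts_of_def\<close>)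
  have "flat_connection M L' (projection_connection M L L') \<longleftrightarrow>
    (\<forall>p\<in>verts M. \<exists>\<psi>. obtained_by_prolonging (universal_cover M p) (L \<circ> fst) \<psi> (L' \<circ> fst))"
    using flat_iff_closes_up closes_up_if_locally_prolonging locally_prolonging_if_closes_up by blast
  then show ?thesis
    using flat_iff_closes_up multi_ratio_iff_closes_up[OF assms(6)]
      line_bundle_pair.nowhere_vanishing_if_prolonging[OF cover_line_bundle_pair] by blast
qed

end
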